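(* Let $\Omega\subset\mathbb{H}$ be an open bounded convex polytope and let $m\in\mathbb{N}$ be the number of hyperplanes of $\partial\Omega$ which are not orthogonal to the hyperplane $\{x_3=0\}$. Then $$\frac15\left(\frac{48\sqrt6}{c_m}+1\right)^{-4/3}\int_\Omega\frac{|u(x)|^2}{\delta_C(x)^2}\,dx\;\le\;\int_\Omega|\nabla_{\mathbb{H}}u(x)|^2\,dx\qquad\text{for all }u\in C_0^\infty(\Omega),$$ where $c_m$ is a positive solution of $$c_m^{4/3}\,\pi m\,\sqrt{c_m^2+16}\,\left(1+\frac{c_m}{48\sqrt6}\right)^{2/3}=\frac{16}{3}.$$
   Context: $\mathbb{H}$ is the first Heisenberg group: $\mathbb{R}^3$ with the group law $(x_1,x_2,x_3)\boxplus(y_1,y_2,y_3)=\left(x_1+y_1,\;x_2+y_2,\;x_3+y_3-\tfrac12(x_1y_2-x_2y_1)\right)$. Topological notions, convexity, orthogonality and $dx$ (Lebesgue measure) are the Euclidean ones of $\mathbb{R}^3$. The sub-gradient is $\nabla_{\mathbb{H}}=(X_1,X_2)$ with $X_1=\partial_{x_1}+\frac{x_2}{2}\partial_{x_3}$, $X_2=\partial_{x_2}-\frac{x_1}{2}\partial_{x_3}$, so $|\nabla_{\mathbb{H}}u|^2=|X_1u|^2+|X_2u|^2$. A Lipschitz curve $\gamma=(\gamma_1,\gamma_2,\gamma_3):[a,b]\to\mathbb{H}$ is horizontal if $\gamma'(t)\in\mathrm{span}\{(1,0,\gamma_2(t)/2),(0,1,-\gamma_1(t)/2)\}$ (for a.e.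 $t$). The Carnot-Carathéodory distance is $d_C(x,y)=\inf_\gamma\int_a^b\sqrt{\gamma_1'(t)^2+\gamma_2'(t)^2}\,dt$, the infimum being over all horizontal curves connecting $x$ and $y$. For $x\in\Omega$, $\delta_C(x)=\inf_{y\in\partial\Omega}d_C(x,y)$. The hyperplanes of $\partial\Omega$ are the (distinct) planes in $\mathbb{R}^3$ containing the facets of the polytope; such a plane $\{y: n_1y_1+n_2y_2+n_3y_3=c\}$ is not orthogonal to $\{x_3=0\}$ exactly when $n_3\ne0$. $C_0^\infty(\Omega)$ denotes smooth functions with compact support in $\Omega$. *)

theory Defs
  imports "HOL-Analysis.Analysis"
begin

text \<open>
  The Heisenberg group has underlying space \<open>real^3\<close>, with group law
  \<open>(x1,x2,x3) [+] (y1,y2,y3) = (x1 + y1, x2 + y2, x3 + y3 - (x1 * y2 - x2 * y1) / 2)\<close>;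
  the vector fields \<open>X1\<close> and \<open>X2\<close> below are invariant under its left translations.
  Topology, convexity, orthogonality and measure are the Euclidean ones.
\<close>

type_synonym heis = "real^3"

subsection \<open>Smooth functions and the sub-gradient\<close>

text \<open>
  On an open set, a function is \<open>C^(k+1)\<close> iff it is differentiable with all first
  partial derivatives of class \<open>C^k\<close>.
\<close>

primrec C_k_on :: "nat \<Rightarrow> 'a::euclidean_space set \<Rightarrow> ('a \<Rightarrow> 'b::real_normed_vector) \<Rightarrow> bool" where
  "C_k_on 0 S f \<longleftrightarrow> continuous_on S f"
| "C_k_on (Suc k) S f \<longleftrightarrow>
     (\<forall>x\<in>S. f differentiable (at x)) \<and>
     (\<forall>b\<in>Basis. C_k_on k S (\<lambda>x. frechet_derivative f (at x) b))"

definition smooth_on :: "'a::euclidean_space set \<Rightarrow> ('a \<Rightarrow> 'b::real_normed_vector) \<Rightarrow> bool" where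
  "smooth_on S f \<longleftrightarrow> (\<forall>k. C_k_on k S f)"

text \<open>
  Elements of \<open>C_0^\<infinity>(\<Omega>)\<close> are represented by their extension by zero to the whole space.
  They are complex-valued; real-valued ones are included via \<open>of_real\<close>.
\<close>

definition test_functions :: "heis set \<Rightarrow> (heis \<Rightarrow> complex) set" where
  "test_functions \<Omega> =
     {u. smooth_on UNIV u \<and> compact (closure {x. u x \<noteq> 0}) \<and> closure {x. u x \<noteq> 0} \<subseteq> \<Omega>}"

definition pderiv_at :: "3 \<Rightarrow> (heis \<Rightarrow> complex) \<Rightarrow> heis \<Rightarrow> complex" where
  "pderiv_at i u x = frechet_derivative u (at x) (axis i 1)"

definition X1 :: "(heis \<Rightarrow> complex) \<Rightarrow> heis \<Rightarrow> complex" where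
  "X1 u x = pderiv_at 1 u x + (x$2 / 2) *\<^sub>R pderiv_at 3 u x"

definition X2 :: "(heis \<Rightarrow> complex) \<Rightarrow> heis \<Rightarrow> complex" where
  "X2 u x = pderiv_at 2 u x - (x$1 / 2) *\<^sub>R pderiv_at 3 u x"

definition subgradient_norm :: "(heis \<Rightarrow> complex) \<Rightarrow> heis \<Rightarrow> real" where
  "subgradient_norm u x = sqrt ((cmod (X1 u x))\<^sup>2 + (cmod (X2 u x))\<^sup>2)"

subsection \<open>Horizontal curves and the Carnot-Caratheodory distance\<close>

text \<open>
  The one-sided derivatives at \<open>a\<close> and \<open>b\<close> allowed by \<open>at t within {a..b}\<close> affect
  only a null set. Lipschitz continuity is Euclidean.
\<close>

definition horizontal_curve :: "real \<Rightarrow> real \<Rightarrow> (real \<Rightarrow> heis) \<Rightarrow> bool" where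
  "horizontal_curve a b \<gamma> \<longleftrightarrow>
     a \<le> b \<and> (\<exists>L. L-lipschitz_on {a..b} \<gamma>) \<and>
     (AE t in lebesgue. t \<in> {a..b} \<longrightarrow>
        \<gamma> differentiable (at t within {a..b}) \<and>
        vector_derivative \<gamma> (at t within {a..b})
          \<in> span {vector [1, 0, \<gamma> t $ 2 / 2], vector [0, 1, - (\<gamma> t $ 1) / 2]})"

definition horizontal_length :: "real \<Rightarrow> real \<Rightarrow> (real \<Rightarrow> heis) \<Rightarrow> real" where
  "horizontal_length a b \<gamma> =
     (LINT t:{a..b}|lebesgue.
        sqrt ((vector_derivative \<gamma> (at t within {a..b}) $ 1)\<^sup>2 +
              (vector_derivative \<gamma> (at t within {a..b}) $ 2)\<^sup>2))"

text \<open>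
  The infimum is over a set of nonnegative reals; it is nonempty because any two points
  are joined by a horizontal curve.
\<close>

definition cc_dist :: "heis \<Rightarrow> heis \<Rightarrow> real" where
  "cc_dist x y =
     Inf {horizontal_length a b \<gamma> | a b \<gamma>. horizontal_curve a b \<gamma> \<and> \<gamma> a = x \<and> \<gamma> b = y}"

definition cc_dist_boundary :: "heis set \<Rightarrow> heis \<Rightarrow> real" where
  "cc_dist_boundary \<Omega> x = (INF y\<in>frontier \<Omega>. cc_dist x y)"

subsection \<open>Polytopes\<close>

definition open_convex_polytope :: "heis set \<Rightarrow> bool" where
  "open_convex_polytope \<Omega> \<longleftrightarrow>
     open \<Omega> \<and> bounded \<Omega> \<and> convex \<Omega> \<and> \<Omega> \<noteq> {} \<and> polytope (closure \<Omega>)"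

text \<open>Using a set makes facets that lie in the same plane count once.\<close>

definition boundary_hyperplanes :: "heis set \<Rightarrow> heis set set" where
  "boundary_hyperplanes \<Omega> = {affine hull F | F. F facet_of closure \<Omega>}"

definition not_orthogonal_to_horizontal :: "heis set \<Rightarrow> bool" where
  "not_orthogonal_to_horizontal H \<longleftrightarrow> (\<exists>n c. H = {y. n \<bullet> y = c} \<and> n $ 3 \<noteq> 0)"

definition num_nonorthogonal_hyperplanes :: "heis set \<Rightarrow> nat" where
  "num_nonorthogonal_hyperplanes \<Omega> =
     card {H \<in> boundary_hyperplanes \<Omega>. not_orthogonal_to_horizontal H}"

subsection \<open>The constant\<close>

definition is_hardy_constant :: "nat \<Rightarrow> real \<Rightarrow> bool" where
  "is_hardy_constant m c \<longleftrightarrow>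
     c > 0 \<and>
     c powr (4/3) * pi * real m * sqrt (c\<^sup>2 + 16) * (1 + c / (48 * sqrt 6)) powr (2/3) = 16/3"

end

theory Submission
  imports Defs
begin

text \<open>
  Write a half-space bounded by a face as \<open>n \<bullet> y < c\<close>, and let \<open>d = c - n \<bullet> x\<close> be the height of \<open>x\<close> under
  the face. Two weights control the reciprocal square of the Carnot-Caratheodory distance to the boundary.

  The first one is \<open>((n \<bullet> X1)\<^sup>2 + (n \<bullet> X2)\<^sup>2) / d\<^sup>2\<close>. The integral curves of \<open>X1\<close> and \<open>X2\<close> are straight
  lines, the flows preserve Lebesgue measure, and \<open>\<bar>n \<bullet> X1\<bar> / d\<close> is at most the reciprocal of the
  distance to the boundary along the line. The one-dimensional Hardy inequality on these lines therefore
  bounds the integral of the weight against \<open>\<bar>u\<bar>\<^sup>2\<close>, even for the maximum over all faces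
  (\<open>hardy_exit_rate\<close>). The reciprocal exit time satisfies the differential inequality \<open>h' \<ge> h\<^sup>2\<close> along the
  flow, and this is all that the proof uses.

  This weight vanishes where both slopes do, which for a non-vertical face happens over its characteristic
  point. There the second weight \<open>\<bar>n3\<bar> / d\<close> takes over. Up to sign it is the horizontal
  divergence of the field \<open>(- n \<bullet> X2, n \<bullet> X1) / d\<close>, and the squared length of this field is the first weight
  (\<open>hardy_vertical_distance\<close>). This estimate is summed over the non-vertical faces, hence the number \<open>m\<close>.

  A horizontal curve of length \<open>l\<close> from \<open>x\<close> to the face satisfies
  \<open>d \<le> (\<bar>n \<bullet> X1\<bar> + \<bar>n \<bullet> X2\<bar>) l + \<bar>n3\<bar> l\<^sup>2\<close> (\<open>horizontal_curve_displacement\<close>), so \<open>1 / l\<^sup>2\<close> is at most a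
  combination of the two weights (\<open>inverse_boundary_distance_bound\<close>). Altogether the Hardy inequality
  holds with the constant \<open>1 / (64 + 18 m)\<close>, and the equation for \<open>c\<close> makes the claimed constant smaller
  than that (\<open>hardy_constant_bound\<close>).
\<close>

section \<open>Horizontal vector fields and their flows\<close>

lemma inner_heis: "(x::heis) \<bullet> y = x$1 * y$1 + x$2 * y$2 + x$3 * y$3"
  by (simp add: inner_vec_def sum_3)

text \<open>
  The left-invariant vector field \<open>p X1 + q X2\<close>. The horizontal lines
  \<open>t \<mapsto> x + t (p X1 + q X2)(x)\<close> are its integral curves, because the field is constant along
  them; the flow at time \<open>t\<close> is right multiplication by \<open>(t p, t q, 0)\<close>.
\<close>
definition hfield :: "real \<Rightarrow> real \<Rightarrow> heis \<Rightarrow> heis" where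
  "hfield p q x = vector [p, q, (p * x$2 - q * x$1) / 2]"

definition hflow :: "real \<Rightarrow> real \<Rightarrow> real \<Rightarrow> heis \<Rightarrow> heis" where
  "hflow p q t x = x + t *\<^sub>R hfield p q x"

lemma hfield_nth [simp]:
  "hfield p q x $ 1 = p" "hfield p q x $ 2 = q" "hfield p q x $ 3 = (p * x$2 - q * x$1) / 2"
  by (simp_all add: hfield_def)

lemma hflow_nth [simp]:
  "hflow p q t x $ 1 = x$1 + t * p" "hflow p q t x $ 2 = x$2 + t * q"
  "hflow p q t x $ 3 = x$3 + t * ((p * x$2 - q * x$1) / 2)"
  by (simp_all add: hflow_def)

lemma hfield_hflow [simp]: "hfield p q (hflow p q t x) = hfield p q x"
  by (simp add: vec_eq_iff forall_3 algebra_simps)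

lemma hflow_hflow: "hflow p q s (hflow p q t x) = hflow p q (s + t) x"
  by (simp add: hflow_def[of _ _ s] hflow_def[of _ _ "s+t"] scaleR_add_left)
     (simp add: hflow_def)

lemma hflow_0 [simp]: "hflow p q 0 x = x"
  by (simp add: hflow_def)

text \<open>
  The linear part of the field; adding a multiple of it to the identity is a shear, hence has determinant 1.
\<close>
definition hshear :: "real \<Rightarrow> real \<Rightarrow> heis \<Rightarrow> heis" where
  "hshear p q y = vector [0, 0, (p * y$2 - q * y$1) / 2]"

lemma linear_hshear: "linear (hshear p q)"
  by (rule linearI) (simp_all add: hshear_def vec_eq_iff forall_3 field_simps)

lemma hfield_eq_shear: "hfield p q x = vector [p, q, 0] + hshear p q x"
  by (simp add: hshear_def vec_eq_iff forall_3)

lemma continuous_on_hshear [continuous_intros]: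
  "continuous_on S f \<Longrightarrow> continuous_on S (\<lambda>x::'a::euclidean_space. hshear p q (f x))"
  using linear_continuous_on_compose[OF _ linear_hshear] by blast

lemma continuous_on_hfield [continuous_intros]:
  "continuous_on S f \<Longrightarrow> continuous_on S (\<lambda>x::'a::euclidean_space. hfield p q (f x))"
  unfolding hfield_eq_shear by (intro continuous_intros)

lemma continuous_on_hflow [continuous_intros]:
  "continuous_on S f \<Longrightarrow> continuous_on S (\<lambda>x::'a::euclidean_space. hflow p q t (f x))"
  unfolding hflow_def by (intro continuous_intros)

lemma hflow_has_derivative:
  "(hflow p q t has_derivative (\<lambda>y. y + t *\<^sub>R hshear p q y)) (at x within S)"
  unfolding hflow_def[abs_def] hfield_eq_shear
  by (auto intro!: derivative_eq_intros linear_imp_has_derivative[OF linear_hshear])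

lemma det_hflow: "det (matrix (\<lambda>y. y + t *\<^sub>R hshear p q y)) = 1"
  by (simp add: det_3 matrix_def axis_def hshear_def)

text \<open>
  The flow is an affine shear, so it preserves Lebesgue measure. All integrations by parts below
  are consequences of this invariance.
\<close>
lemma hflow_integral:
  fixes w :: "heis \<Rightarrow> real"
  assumes "integrable lebesgue w"
  shows "integrable lebesgue (\<lambda>x. w (hflow p q t x))"
    and "(\<integral>x. w (hflow p q t x) \<partial>lebesgue) = (\<integral>x. w x \<partial>lebesgue)"
proof -
  have rng: "range (hflow p q t) = UNIV"
    by (rule surjI[of _ "hflow p q (-t)"]) (simp add: hflow_hflow)
  (* The change of variables theorem is about vector-valued functions, hence the detour through real^1. *)
  define v where "v = (\<lambda>x. vec (w x) :: real^1)"
  have v: "v absolutely_integrable_on UNIV"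
    using assms unfolding v_def absolutely_integrable_on_1_iff by (simp add: set_integrable_def)
  have "(\<lambda>x. \<bar>det (matrix (\<lambda>y. y + t *\<^sub>R hshear p q y))\<bar> *\<^sub>R v (hflow p q t x)) absolutely_integrable_on UNIV \<and>
    integral UNIV (\<lambda>x. \<bar>det (matrix (\<lambda>y. y + t *\<^sub>R hshear p q y))\<bar> *\<^sub>R v (hflow p q t x)) = integral UNIV v \<longleftrightarrow>
         v absolutely_integrable_on (range (hflow p q t)) \<and> integral (range (hflow p q t)) v = integral UNIV v"
    by (rule has_absolute_integral_change_of_variables_invertible[where h="hflow p q (-t)" and S=UNIV])
       (auto intro!: hflow_has_derivative continuous_intros simp: hflow_hflow)
  then have *: "(\<lambda>x. v (hflow p q t x)) absolutely_integrable_on UNIV"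
    "integral UNIV (\<lambda>x. v (hflow p q t x)) = integral UNIV v"
    using v by (auto simp: det_hflow rng)
  show 1: "integrable lebesgue (\<lambda>x. w (hflow p q t x))" 
    using *(1) unfolding v_def absolutely_integrable_on_1_iff by (simp add: set_integrable_def)
  have "integral UNIV (\<lambda>x. w (hflow p q t x)) = integral UNIV w"
    using *(2) unfolding v_def integral_on_1_eq by simp
  then show "(\<integral>x. w (hflow p q t x) \<partial>lebesgue) = (\<integral>x. w x \<partial>lebesgue)"
    by (simp add: integral_lebesgue[OF 1] integral_lebesgue[OF assms])
qed

lemma integrable_lebesgue_compact_support:
  fixes g :: "'a::euclidean_space \<Rightarrow> real"
  assumes "compact K" "continuous_on K g" "\<And>x. x \<notin> K \<Longrightarrow> g x = 0"
  shows "integrable lebesgue g"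
proof -
  have "integrable lebesgue (\<lambda>x. indicator K x *\<^sub>R g x)"
    using borel_integrable_compact[OF assms(1,2)] by (intro integrable_completion[THEN iffD2]) auto
  also have "(\<lambda>x. indicator K x *\<^sub>R g x) = g"
    using assms(3) by (auto simp: indicator_def fun_eq_iff)
  finally show ?thesis .
qed

lemma DERIV_along_hflow:
  fixes f :: "heis \<Rightarrow> real"
  assumes "\<And>x. (f has_derivative f' x) (at x)"
  shows "((\<lambda>s. f (hflow p q s x)) has_field_derivative f' (hflow p q s x) (hfield p q x)) (at s)"
proof -
  have "((\<lambda>s. hflow p q s x) has_derivative (\<lambda>s. s *\<^sub>R hfield p q x)) (at s)"
    unfolding hflow_def by (auto intro!: derivative_eq_intros)
  from has_derivative_compose[OF this assms[of "hflow p q s x"]]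
  show ?thesis
    unfolding has_field_derivative_def
    by (rule has_derivative_eq_rhs)
       (use linear_scale[OF has_derivative_linear[OF assms]] in \<open>auto simp: mult.commute\<close>)
qed

text \<open>
  If \<open>h\<close> grows along the flow at least at the rate \<open>k\<close>, then \<open>k f\<close> integrates to at most
  minus the integral of \<open>h\<close> times the derivative of \<open>f\<close>. Moving the difference quotient from
  \<open>h\<close> to \<open>f\<close> by measure invariance and letting \<open>t\<close> tend to 0 avoids any differentiability
  of \<open>h\<close>, which will be a maximum of finitely many functions.
\<close>
lemma integration_by_parts_along_hflow:
  fixes f :: "heis \<Rightarrow> real" and f' :: "heis \<Rightarrow> heis \<Rightarrow> real"
  assumes "open \<Omega>" and K: "compact K" "K \<subseteq> \<Omega>"
    and f: "\<And>x. (f has_derivative f' x) (at x)"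
    and cont: "continuous_on UNIV (\<lambda>x. f' x (hfield p q x))"
    and nonneg: "\<And>x. f x \<ge> 0" and zero: "\<And>x. x \<notin> K \<Longrightarrow> f x = 0"
    and h: "continuous_on \<Omega> h" and k: "continuous_on \<Omega> k"
    and "\<tau> > 0"
    and hk: "\<And>x t. x \<in> K \<Longrightarrow> 0 < t \<Longrightarrow> t < \<tau> \<Longrightarrow> hflow p q t x \<in> \<Omega> \<Longrightarrow>
       t * k x - C * t\<^sup>2 \<le> h (hflow p q t x) - h x"
  shows "(\<integral>x. k x * f x \<partial>lebesgue) \<le> - (\<integral>x. h x * f' x (hfield p q x) \<partial>lebesgue)"
proof -
  define D where "D = (\<lambda>x. f' x (hfield p q x))"
  have f_cont: "continuous_on S f" for S
    by (meson f has_derivative_continuous continuous_at_imp_continuous_on)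
  have D0: "D x = 0" if "x \<notin> K" for x
  proof -
    have "f' x = (\<lambda>_. 0)"
    proof (rule has_derivative_unique[OF f])
      show "(f has_derivative (\<lambda>_. 0)) (at x)"
        by (rule has_derivative_transform_within_open[of "\<lambda>_. 0" _ _ _ "-K"])
           (use that zero K in \<open>auto simp: compact_imp_closed\<close>)
    qed
    then show ?thesis by (simp add: D_def)
  qed
  have "bounded (D ` K)"
    by (intro compact_imp_bounded compact_continuous_image continuous_on_subset[OF cont[folded D_def]] K) auto
  then obtain B where "B > 0" and B': "\<And>x. x \<in> K \<Longrightarrow> \<bar>D x\<bar> \<le> B"
    unfolding bounded_pos by auto
  have B: "\<bar>D x\<bar> \<le> B" for x
    using B'[of x] D0[of x] \<open>B > 0\<close> by (cases "x \<in> K") auto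
  have "bounded (hfield p q ` K)"
    by (intro compact_imp_bounded compact_continuous_image continuous_intros K)
  then obtain M where "M > 0" and M: "\<And>x. x \<in> K \<Longrightarrow> norm (hfield p q x) \<le> M"
    unfolding bounded_pos by auto
  obtain \<epsilon> where "\<epsilon> > 0" and \<epsilon>: "(\<Union>x\<in>K. cball x \<epsilon>) \<subseteq> \<Omega>"
    using compact_subset_open_imp_cball_epsilon_subset[OF K(1) \<open>open \<Omega>\<close> K(2)] .
  define t1 where "t1 = min (\<tau> / 2) (\<epsilon> / M)"
  have t1: "t1 > 0" "t1 < \<tau>" "t1 * M \<le> \<epsilon>"
    using \<open>\<tau> > 0\<close> \<open>\<epsilon> > 0\<close> \<open>M > 0\<close> by (auto simp: t1_def min_def field_simps)
  define K' where "K' = (\<lambda>z. hflow p q (fst z) (snd z)) ` ({0..t1} \<times> K)"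
  have "compact K'"
    unfolding K'_def hflow_def
    by (intro compact_continuous_image compact_Times K continuous_intros) auto
  have K'I: "hflow p q t x \<in> K'" if "0 \<le> t" "t \<le> t1" "x \<in> K" for t x
    unfolding K'_def using that by force
  have "K \<subseteq> K'"
    using K'I[of 0] t1 by auto
  have "K' \<subseteq> \<Omega>"
  proof
    fix y assume "y \<in> K'"
    then obtain t x where tx: "0 \<le> t" "t \<le> t1" "x \<in> K" "y = hflow p q t x"
      unfolding K'_def by auto
    have "norm (t *\<^sub>R hfield p q x) \<le> t1 * M"
      using tx M[of x] by (auto intro!: mult_mono)
    then have "y \<in> cball x \<epsilon>"
      using t1 tx by (simp add: hflow_def dist_norm)
    then show "y \<in> \<Omega>" using \<epsilon> tx(3) by blast
  qed
  have hK': "continuous_on K' h"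
    using h \<open>K' \<subseteq> \<Omega>\<close> by (rule continuous_on_subset)
  (* Cutting h off outside K' makes every integrand below integrable; for t \<le> t1 the flow
     moves K inside K', so the cut is not seen. *)
  define hK where "hK = (\<lambda>x. indicator K' x * h x)"
  have int_hK: "integrable lebesgue (\<lambda>x. hK x * g x)" if "continuous_on UNIV g" for g
  proof (rule integrable_lebesgue_compact_support[OF \<open>compact K'\<close>])
    have "continuous_on K' (\<lambda>x. h x * g x)"
      by (intro continuous_intros hK' continuous_on_subset[OF that]) auto
    then show "continuous_on K' (\<lambda>x. hK x * g x)"
      by (subst continuous_on_cong[OF refl, of _ _ "\<lambda>x. h x * g x"]) (auto simp: hK_def)
  qed (auto simp: hK_def)
  have int_f: "integrable lebesgue (\<lambda>x. k x * f x)" "integrable lebesgue f"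
    by (rule integrable_lebesgue_compact_support[OF K(1)]; 
        auto intro!: continuous_intros continuous_on_subset[OF k K(2)] f_cont simp: zero)+
  have step: "(\<integral>x. k x * f x \<partial>lebesgue) - C * t * (\<integral>x. f x \<partial>lebesgue)
      \<le> (\<integral>x. hK x * ((f (hflow p q (-t) x) - f x) / t) \<partial>lebesgue)" if t: "0 < t" "t \<le> t1" for t
  proof -
    have i1: "integrable lebesgue (\<lambda>x. hK x * f (hflow p q (-t) x))"
      by (intro int_hK continuous_on_compose2[OF f_cont[of UNIV]] continuous_intros) auto
    have i2: "integrable lebesgue (\<lambda>x. hK x * f x)"
      by (intro int_hK f_cont)
    note fl = hflow_integral[OF i1, of p q t, unfolded hflow_hflow]
    have i3: "integrable lebesgue (\<lambda>x. hK (hflow p q t x) * f x)"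
      using fl(1) by simp
    have e3: "(\<integral>x. hK (hflow p q t x) * f x \<partial>lebesgue) = (\<integral>x. hK x * f (hflow p q (-t) x) \<partial>lebesgue)"
      using fl(2) by simp
    have "(\<integral>x. t * (k x * f x) - C * t\<^sup>2 * f x \<partial>lebesgue)
      \<le> (\<integral>x. hK (hflow p q t x) * f x - hK x * f x \<partial>lebesgue)"
    proof (rule integral_mono)
      fix x
      show "t * (k x * f x) - C * t\<^sup>2 * f x \<le> hK (hflow p q t x) * f x - hK x * f x"
      proof (cases "x \<in> K")
        case True
        have "hflow p q t x \<in> K'" using K'I True t by auto
        then have "t * k x - C * t\<^sup>2 \<le> hK (hflow p q t x) - hK x"
          using hk[of x t] True t t1 subsetD[OF \<open>K \<subseteq> K'\<close> True] \<open>K' \<subseteq> \<Omega>\<close> by (auto simp: hK_def)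
        from mult_right_mono[OF this nonneg[of x]] show ?thesis
          by (simp add: algebra_simps)
      qed (simp add: zero)
    qed (use int_f i2 i3 in \<open>auto intro!: Bochner_Integration.integrable_diff\<close>)
    then have "t * (\<integral>x. k x * f x \<partial>lebesgue) - C * t\<^sup>2 * (\<integral>x. f x \<partial>lebesgue)
       \<le> (\<integral>x. hK x * f (hflow p q (-t) x) \<partial>lebesgue) - (\<integral>x. hK x * f x \<partial>lebesgue)"
      using int_f i2 i3 by (simp add: e3)
    also have "\<dots> = (\<integral>x. hK x * f (hflow p q (-t) x) - hK x * f x \<partial>lebesgue)"
      using i1 i2 by simp
    also have "\<dots> = (\<integral>x. t * (hK x * ((f (hflow p q (-t) x) - f x) / t)) \<partial>lebesgue)"
      using t by (intro Bochner_Integration.integral_cong) (auto simp: field_simps)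
    also have "\<dots> = t * (\<integral>x. hK x * ((f (hflow p q (-t) x) - f x) / t) \<partial>lebesgue)"
      by simp
    finally have "t * ((\<integral>x. k x * f x \<partial>lebesgue) - C * t * (\<integral>x. f x \<partial>lebesgue))
       \<le> t * (\<integral>x. hK x * ((f (hflow p q (-t) x) - f x) / t) \<partial>lebesgue)"
      by (simp add: algebra_simps power2_eq_square)
    then show ?thesis using t by (simp only: mult_le_cancel_left_pos)
  qed
  define t where "t = (\<lambda>n. t1 / real (Suc n))"
  have t_lim: "t \<longlonglongrightarrow> 0"
    unfolding t_def using tendsto_mult[OF tendsto_const LIMSEQ_inverse_real_of_nat, of t1]
    by (simp add: divide_inverse)
  have t_pos: "0 < t n" "t n \<le> t1" for n
    using t1 by (auto simp: t_def field_simps)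
  have "(\<lambda>n. \<integral>x. hK x * ((f (hflow p q (- t n) x) - f x) / t n) \<partial>lebesgue)
      \<longlonglongrightarrow> (\<integral>x. hK x * (- D x) \<partial>lebesgue)"
  proof (rule integral_dominated_convergence)
    show "(\<lambda>x. hK x * (- D x)) \<in> borel_measurable lebesgue"
      using cont by (intro borel_measurable_integrable int_hK) (auto intro!: continuous_intros simp: D_def)
    show "(\<lambda>x. hK x * ((f (hflow p q (- t n) x) - f x) / t n)) \<in> borel_measurable lebesgue" for n
      using t_pos(1)[of n]
      by (intro borel_measurable_integrable int_hK continuous_intros
          continuous_on_compose2[OF f_cont[of UNIV]]) (auto simp: f_cont)
    show "integrable lebesgue (\<lambda>x. \<bar>hK x * B\<bar>)"
      using int_hK[of "\<lambda>_. B"] by (intro integrable_abs) auto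
    show "AE x in lebesgue. (\<lambda>n. hK x * ((f (hflow p q (- t n) x) - f x) / t n)) \<longlonglongrightarrow> hK x * (- D x)"
    proof (intro AE_I2 tendsto_mult tendsto_const)
      fix x
      have "((\<lambda>s. f (hflow p q s x)) has_field_derivative D x) (at 0)"
        using DERIV_along_hflow[OF f, of p q x 0] by (simp add: D_def)
      then have "((\<lambda>s. (f (hflow p q s x) - f x) / s) \<longlongrightarrow> D x) (at 0)"
        by (simp add: has_field_derivative_iff)
      moreover have "filterlim (\<lambda>n. - t n) (at 0) sequentially"
        using t_pos(1) tendsto_minus[OF t_lim]
        by (auto simp: filterlim_at intro!: always_eventually) (metis less_irrefl)
      ultimately have "(\<lambda>n. (f (hflow p q (- t n) x) - f x) / (- t n)) \<longlonglongrightarrow> D x"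
        by (rule filterlim_compose)
      then show "(\<lambda>n. (f (hflow p q (- t n) x) - f x) / t n) \<longlonglongrightarrow> - D x"
        using tendsto_minus by fastforce
    qed
    show "AE x in lebesgue. norm (hK x * ((f (hflow p q (- t n) x) - f x) / t n)) \<le> \<bar>hK x * B\<bar>" for n
    proof (intro AE_I2)
      fix x
      have "\<exists>z>- t n. z < 0 \<and> f (hflow p q 0 x) - f (hflow p q (- t n) x)
          = (0 - (- t n)) * f' (hflow p q z x) (hfield p q x)"
        using t_pos(1)[of n] by (intro MVT2 DERIV_along_hflow f) auto
      then obtain z where "f x - f (hflow p q (- t n) x) = t n * D (hflow p q z x)"
        by (auto simp: D_def)
      then have "(f (hflow p q (- t n) x) - f x) / t n = - D (hflow p q z x)"
        using t_pos(1)[of n] by (auto simp: field_simps)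
      then show "norm (hK x * ((f (hflow p q (- t n) x) - f x) / t n)) \<le> \<bar>hK x * B\<bar>"
        using B[of "hflow p q z x"] \<open>B > 0\<close> by (simp add: abs_mult mult_left_mono)
    qed
  qed
  moreover have "(\<lambda>n. (\<integral>x. k x * f x \<partial>lebesgue) - C * t n * (\<integral>x. f x \<partial>lebesgue))
      \<longlonglongrightarrow> (\<integral>x. k x * f x \<partial>lebesgue) - C * 0 * (\<integral>x. f x \<partial>lebesgue)"
    by (intro tendsto_intros t_lim)
  ultimately have "(\<integral>x. k x * f x \<partial>lebesgue) - C * 0 * (\<integral>x. f x \<partial>lebesgue)
      \<le> (\<integral>x. hK x * (- D x) \<partial>lebesgue)"
    using step t_pos by (intro LIMSEQ_le) blast+
  also have "(\<integral>x. hK x * (- D x) \<partial>lebesgue) = - (\<integral>x. h x * D x \<partial>lebesgue)"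
    unfolding integral_minus[symmetric]
    using \<open>K \<subseteq> K'\<close> D0 by (intro Bochner_Integration.integral_cong) (auto simp: hK_def indicator_def)
  finally show ?thesis by (simp add: D_def)
qed

section \<open>Horizontal curves\<close>

text \<open>
  The gauge argument for the usual fundamental theorem handles the tags outside \<open>N\<close>. The intervals
  tagged in \<open>N\<close> have small total length, since the indicator of \<open>N\<close> has integral 0, and the
  Lipschitz bound turns this into a small total increment of \<open>f\<close>.
\<close>
lemma fundamental_theorem_of_calculus_lipschitz:
  fixes f :: "real \<Rightarrow> real"
  assumes "a \<le> b" and L: "L-lipschitz_on {a..b} f" and N: "negligible N"
    and der: "\<And>x. x \<in> {a..b} - N \<Longrightarrow> (f has_vector_derivative f' x) (at x within {a..b})"
  shows "(f' has_integral (f b - f a)) {a..b}"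
proof -
  define g where "g = (\<lambda>x. if x \<in> N then 0 else f' x)"
  have "L \<ge> 0" using L by (rule lipschitz_on_nonneg)
  have "(g has_integral (f b - f a)) {a..b}"
    unfolding has_integral_real
  proof (intro allI impI)
    fix e :: real assume "e > 0"
    define e1 where "e1 = e / (2 * (b - a + 1))"
    have e1: "e1 > 0" "e1 * (b - a) < e / 2"
      using \<open>e > 0\<close> \<open>a \<le> b\<close> by (auto simp: e1_def field_simps)
    define e2 where "e2 = e / (2 * (L + 1))"
    have e2: "e2 > 0" "L * e2 \<le> e / 2"
      using \<open>e > 0\<close> \<open>L \<ge> 0\<close> by (auto simp: e2_def field_simps)
    have "((indicator N :: real \<Rightarrow> real) has_integral 0) {a..b}"
      using N unfolding negligible_def by (metis box_real(2))
    then obtain d0 where "gauge d0" and d0: "\<And>p. p tagged_division_of {a..b} \<Longrightarrow> d0 fine p \<Longrightarrow>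
        norm (sum (\<lambda>(x,k). measure lborel k *\<^sub>R (indicator N x :: real)) p) < e2"
      unfolding has_integral_real using e2(1) by (metis (no_types, lifting) diff_zero)
    have "\<forall>x. \<exists>d>0. x \<in> {a..b} - N \<longrightarrow>
         (\<forall>y\<in>{a..b}. norm (y-x) < d \<longrightarrow> norm (f y - f x - (y-x) *\<^sub>R f' x) \<le> e1 * norm (y-x))"
      using der[unfolded has_vector_derivative_def has_derivative_within_alt] e1(1) 
      by (metis zero_less_one)
    then obtain d where d: "\<And>x. 0 < d x"
                   "\<And>x y. \<lbrakk>x \<in> {a..b} - N; y \<in> {a..b}; norm (y-x) < d x\<rbrakk>
                          \<Longrightarrow> norm (f y - f x - (y-x) *\<^sub>R f' x) \<le> e1 * norm (y-x)"
      by metis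
    show "\<exists>\<gamma>. gauge \<gamma> \<and> (\<forall>p. p tagged_division_of {a..b} \<and> \<gamma> fine p \<longrightarrow>
        norm (sum (\<lambda>(x,k). measure lborel k *\<^sub>R g x) p - (f b - f a)) < e)"
    proof (intro exI[of _ "\<lambda>x. d0 x \<inter> ball x (d x)"] conjI allI impI; (elim conjE)?)
      show "gauge (\<lambda>x. d0 x \<inter> ball x (d x))"
        using \<open>gauge d0\<close> d(1) by (intro gauge_Int gauge_ball_dependent) auto
    next
      fix p
      assume p: "p tagged_division_of {a..b}" and "(\<lambda>x. d0 x \<inter> ball x (d x)) fine p"
      then have fine: "d0 fine p" "(\<lambda>x. ball x (d x)) fine p"
        by (auto simp: fine_Int)
      have eqs: "b - a = (\<Sum>(x,K)\<in>p. Sup K - Inf K)" "f b - f a = (\<Sum>(x,K)\<in>p. f (Sup K) - f (Inf K))"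
        using additive_tagged_division_1[OF \<open>a \<le> b\<close>, of p "\<lambda>x. x"] additive_tagged_division_1[OF \<open>a \<le> b\<close>, of p f] p
        by auto
      have "norm (sum (\<lambda>(x,k). measure lborel k *\<^sub>R g x) p - (f b - f a))
          = norm (\<Sum>(x,K)\<in>p. measure lborel K *\<^sub>R g x - (f (Sup K) - f (Inf K)))"
        by (simp add: eqs sum_subtractf split_def)
      also have "\<dots> \<le> (\<Sum>(x,K)\<in>p. e1 * (Sup K - Inf K) + L * (measure lborel K *\<^sub>R indicator N x))"
      proof (rule sum_norm_le, clarify)
        fix x K assume xK: "(x, K) \<in> p"
        then have "x \<in> K" and kab: "K \<subseteq> {a..b}"
          using p by blast+
        then obtain u v where k: "K = {u..v}"
          using p xK by (metis box_real(2) tagged_division_ofD(4))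
        have uv: "u \<le> v" "u \<in> K" "v \<in> K"
          using \<open>x \<in> K\<close> unfolding k by auto
        have ball: "K \<subseteq> ball x (d x)"
          using fine(2) xK by blast
        have ck: "measure lborel K = v - u" "Sup K = v" "Inf K = u" using uv by (auto simp: k)
        show "norm (measure lborel K *\<^sub>R g x - (f (Sup K) - f (Inf K))) \<le> e1 * (Sup K - Inf K) + L * (measure lborel K *\<^sub>R indicator N x)"
        proof (cases "x \<in> N")
          case True
          have "\<bar>f v - f u\<bar> \<le> L * (v - u)"
            using lipschitz_onD[OF L, of v u] uv subsetD[OF kab uv(2)] subsetD[OF kab uv(3)]
            by (simp add: dist_real_def)
          then show ?thesis
            using True uv e1 by (simp add: g_def ck add_increasing mult.commute)
        next
          case False
          have x: "x \<in> {a..b} - N" using False kab \<open>x \<in> K\<close> by auto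
          have 1: "norm (f u - f x - (u - x) *\<^sub>R f' x) \<le> e1 * norm (u - x)"
            using uv ball kab by (intro d(2) x) (auto simp: dist_real_def)
          have 2: "norm (f v - f x - (v - x) *\<^sub>R f' x) \<le> e1 * norm (v - x)"
            using uv ball kab by (intro d(2) x) (auto simp: dist_real_def)
          have "u \<le> x" "x \<le> v" using \<open>x \<in> K\<close> k by auto
          then have "e1 * norm (u - x) + e1 * norm (v - x) = e1 * (v - u)"
            by (simp add: algebra_simps)
          moreover have "(v - u) * f' x - (f v - f u) = 
            (f u - f x - (u - x) *\<^sub>R f' x) - (f v - f x - (v - x) *\<^sub>R f' x)"
            by (simp add: algebra_simps)
          ultimately have "norm ((v - u) * f' x - (f v - f u)) \<le> e1 * (v - u)"
            using 1 2 norm_triangle_ineq4[of "f u - f x - (u - x) *\<^sub>R f' x" "f v - f x - (v - x) *\<^sub>R f' x"]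
            by (simp only:)
          then show ?thesis
            using False by (simp add: g_def ck)
        qed
      qed
      also have "\<dots> = e1 * (b - a) + L * (\<Sum>(x,K)\<in>p. measure lborel K *\<^sub>R indicator N x)"
        by (simp add: eqs sum.distrib sum_distrib_left split_def)
      also have "\<dots> < e / 2 + e / 2"
      proof (rule add_less_le_mono)
        have "L * (\<Sum>(x,K)\<in>p. measure lborel K *\<^sub>R indicator N x) \<le> L * e2"
          using d0[OF p fine(1)] \<open>L \<ge> 0\<close> by (intro mult_left_mono) auto
        then show "L * (\<Sum>(x,K)\<in>p. measure lborel K *\<^sub>R indicator N x) \<le> e / 2"
          using e2 by linarith
      qed (use e1 in auto)
      finally show "norm (sum (\<lambda>(x,k). measure lborel k *\<^sub>R g x) p - (f b - f a)) < e" by simp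
    qed
  qed
  then show ?thesis
    by (rule has_integral_spike[OF N, rotated]) (auto simp: g_def)
qed

lemma lipschitz_derivative_bound:
  fixes f :: "real \<Rightarrow> real"
  assumes L: "L-lipschitz_on {a..b} f" and "a < b" "x \<in> {a..b}"
    and "(f has_vector_derivative D) (at x within {a..b})"
  shows "\<bar>D\<bar> \<le> L"
proof -
  have "((\<lambda>y. (f y - f x) / (y - x)) \<longlongrightarrow> D) (at x within {a..b})"
    using assms(4) by (simp add: has_real_derivative_iff_has_vector_derivative[symmetric] has_field_derivative_iff)
  moreover have "at x within {a..b} \<noteq> bot"
    using assms(2,3) by (simp add: trivial_limit_within)
  moreover have "eventually (\<lambda>y. norm ((f y - f x) / (y - x)) \<le> L) (at x within {a..b})"
    unfolding eventually_at
  proof (intro exI[of _ 1] conjI ballI impI)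
    fix y assume "y \<in> {a..b}" "y \<noteq> x \<and> dist y x < 1"
    then show "norm ((f y - f x) / (y - x)) \<le> L"
      using lipschitz_onD[OF L, of y x] assms(3) by (simp add: dist_real_def divide_le_eq)
  qed auto
  ultimately have "norm D \<le> L"
    by (intro Lim_norm_ubound[of "at x within {a..b}"]) auto
  then show ?thesis by simp
qed

lemma absolutely_integrable_lipschitz_derivative:
  fixes f :: "real \<Rightarrow> real"
  assumes "a < b" and L: "L-lipschitz_on {a..b} f" and N: "negligible N"
    and der: "\<And>x. x \<in> {a..b} - N \<Longrightarrow> (f has_vector_derivative f' x) (at x within {a..b})"
  shows "f' absolutely_integrable_on {a..b}"
proof -
  define g where "g = (\<lambda>x. if x \<in> N then 0 else f' x)"
  have "g absolutely_integrable_on {a..b}"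
  proof (rule absolutely_integrable_integrable_bound)
    show "norm (g x) \<le> L" if "x \<in> {a..b}" for x
      using lipschitz_derivative_bound[OF L \<open>a < b\<close> that der] that lipschitz_on_nonneg[OF L]
      by (auto simp: g_def)
    show "g integrable_on {a..b}"
      using fundamental_theorem_of_calculus_lipschitz[OF less_imp_le[OF \<open>a < b\<close>] L N, of g] der
      by (auto simp: g_def)
  qed auto
  then show ?thesis
    by (rule absolutely_integrable_spike[OF _ N]) (auto simp: g_def)
qed

text \<open>
  Along a horizontal curve the linear function \<open>y \<mapsto> n \<bullet> y\<close> changes at the rate
  \<open>\<gamma>1' (n \<bullet> X1) + \<gamma>2' (n \<bullet> X2)\<close>, and the slopes \<open>n \<bullet> X1\<close> and \<open>n \<bullet> X2\<close> move by at most
  \<open>\<bar>n3\<bar> l / 2\<close> on a curve of length \<open>l\<close>. Hence reaching a plane at height \<open>d\<close> requires a length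
  comparable to \<open>d\<close> over the slope, or to the square root of \<open>d / \<bar>n3\<bar>\<close>.
\<close>
lemma horizontal_curve_displacement:
  assumes \<gamma>: "horizontal_curve a b \<gamma>"
  defines "l \<equiv> horizontal_length a b \<gamma>"
  shows "n \<bullet> \<gamma> b - n \<bullet> \<gamma> a
      \<le> (\<bar>n \<bullet> hfield 1 0 (\<gamma> a)\<bar> + \<bar>n \<bullet> hfield 0 1 (\<gamma> a)\<bar>) * l + \<bar>n$3\<bar> * l\<^sup>2"
    and "l \<ge> 0"
proof -
  show "l \<ge> 0"
    unfolding l_def horizontal_length_def set_lebesgue_integral_def
    by (intro integral_nonneg_AE AE_I2) auto
  have "a \<le> b" using \<gamma> by (simp add: horizontal_curve_def)
  show "n \<bullet> \<gamma> b - n \<bullet> \<gamma> a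
      \<le> (\<bar>n \<bullet> hfield 1 0 (\<gamma> a)\<bar> + \<bar>n \<bullet> hfield 0 1 (\<gamma> a)\<bar>) * l + \<bar>n$3\<bar> * l\<^sup>2"
  proof (cases "a = b")
    case True
    then show ?thesis using \<open>l \<ge> 0\<close> by simp
  next
    case False
    with \<open>a \<le> b\<close> have "a < b" by simp
    obtain L where L: "L-lipschitz_on {a..b} \<gamma>"
      using \<gamma> by (auto simp: horizontal_curve_def)
    define w where "w = (\<lambda>t. vector_derivative \<gamma> (at t within {a..b}))"
    have "AE t in lebesgue. t \<in> {a..b} \<longrightarrow>
        \<gamma> differentiable (at t within {a..b}) \<and>
        w t \<in> span {vector [1, 0, \<gamma> t $ 2 / 2], vector [0, 1, - (\<gamma> t $ 1) / 2]}"
      using \<gamma> by (simp add: horizontal_curve_def w_def)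
    then obtain N where N: "negligible N" and "{t. \<not> (t \<in> {a..b} \<longrightarrow>
        \<gamma> differentiable (at t within {a..b}) \<and>
        w t \<in> span {vector [1, 0, \<gamma> t $ 2 / 2], vector [0, 1, - (\<gamma> t $ 1) / 2]})} \<subseteq> N"
      unfolding eventually_ae_filter negligible_iff_null_sets by auto
    then have Nd: "\<gamma> differentiable (at t within {a..b})"
      and Ns: "w t \<in> span {vector [1, 0, \<gamma> t $ 2 / 2], vector [0, 1, - (\<gamma> t $ 1) / 2]}"
      if "t \<in> {a..b} - N" for t using that by auto
    have der: "((\<lambda>t. v \<bullet> \<gamma> t) has_vector_derivative v \<bullet> w t) (at t within {a..b})"
      if "t \<in> {a..b} - N" for t v
      using Nd[OF that] unfolding vector_derivative_works w_def
      by (rule bounded_linear.has_vector_derivative[OF bounded_linear_inner_right])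
    have lip: "(norm v * L)-lipschitz_on {a..b} (\<lambda>t. v \<bullet> \<gamma> t)" for v
    proof (rule lipschitz_onI)
      fix x y assume "x \<in> {a..b}" "y \<in> {a..b}"
      have "\<bar>v \<bullet> \<gamma> x - v \<bullet> \<gamma> y\<bar> \<le> norm v * norm (\<gamma> x - \<gamma> y)"
        by (metis Cauchy_Schwarz_ineq2 inner_diff_right)
      also have "\<dots> \<le> norm v * (L * dist x y)"
        using lipschitz_onD[OF L \<open>x \<in> {a..b}\<close> \<open>y \<in> {a..b}\<close>]
        by (intro mult_left_mono) (auto simp: dist_norm)
      finally show "dist (v \<bullet> \<gamma> x) (v \<bullet> \<gamma> y) \<le> norm v * L * dist x y"
        by (simp add: dist_real_def mult.assoc)
    qed (use lipschitz_on_nonneg[OF L] in simp)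
    have ai: "(\<lambda>t. v \<bullet> w t) absolutely_integrable_on {a..b}" for v
      by (rule absolutely_integrable_lipschitz_derivative[OF \<open>a < b\<close> lip N der])
    define s where "s = (\<lambda>t. sqrt ((w t $ 1)\<^sup>2 + (w t $ 2)\<^sup>2))"
    have s1: "\<bar>w t $ 1\<bar> \<le> s t" and s2: "\<bar>w t $ 2\<bar> \<le> s t" and s0: "0 \<le> s t" for t
      by (auto simp: s_def)
    have "(\<lambda>t. cmod ((w t $ 1) *\<^sub>R 1 + (w t $ 2) *\<^sub>R \<i>)) absolutely_integrable_on {a..b}"
      using ai[of "axis 1 1"] ai[of "axis 2 1"]
      by (intro absolutely_integrable_norm[unfolded o_def] set_integral_add set_integrable_scaleR_left)
         (simp_all add: inner_axis')
    moreover have "cmod ((w t $ 1) *\<^sub>R 1 + (w t $ 2) *\<^sub>R \<i>) = s t" for t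
      by (simp add: cmod_def s_def)
    ultimately have s_ai: "s absolutely_integrable_on {a..b}" by simp
    then have s_int: "s integrable_on {a..b}" 
      by (rule set_lebesgue_integral_eq_integral(1))
    have l: "l = integral {a..b} s"
      using set_lebesgue_integral_eq_integral(2)[OF s_ai]
      by (simp add: l_def horizontal_length_def s_def w_def)
    have move: "\<bar>v \<bullet> \<gamma> c - v \<bullet> \<gamma> a\<bar> \<le> l"
      if c: "c \<in> {a..b}" and v: "\<And>t. \<bar>v \<bullet> w t\<bar> \<le> s t" for c v
    proof -
      have "((\<lambda>t. v \<bullet> w t) has_integral (v \<bullet> \<gamma> c - v \<bullet> \<gamma> a)) {a..c}"
      proof (rule fundamental_theorem_of_calculus_lipschitz[OF _ _ N])
        show "(norm v * L)-lipschitz_on {a..c} (\<lambda>t. v \<bullet> \<gamma> t)"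
          by (rule lipschitz_on_subset[OF lip]) (use c in auto)
        show "((\<lambda>t. v \<bullet> \<gamma> t) has_vector_derivative v \<bullet> w t) (at t within {a..c})"
          if "t \<in> {a..c} - N" for t
          by (rule has_vector_derivative_within_subset[OF der]) (use that c in auto)
      qed (use c in auto)
      then have "\<bar>v \<bullet> \<gamma> c - v \<bullet> \<gamma> a\<bar> = norm (integral {a..c} (\<lambda>t. v \<bullet> w t))"
        by (simp add: integral_unique)
      also have "\<dots> \<le> integral {a..c} s"
        using c v integrable_on_subinterval[OF s_int, of a c] 
          \<open>((\<lambda>t. v \<bullet> w t) has_integral _) {a..c}\<close>
        by (intro integral_norm_bound_integral) auto
      also have "\<dots> \<le> integral {a..b} s"
        using c s0 integrable_on_subinterval[OF s_int, of a c] s_int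
        by (intro integral_subset_le) auto
      finally show ?thesis by (simp add: l)
    qed
    define A where "A = \<bar>n \<bullet> hfield 1 0 (\<gamma> a)\<bar> + \<bar>n \<bullet> hfield 0 1 (\<gamma> a)\<bar> + \<bar>n$3\<bar> * l"
    have slope: "n \<bullet> w t \<le> A * s t" if t: "t \<in> {a..b} - N" for t
    proof -
      obtain \<alpha> \<beta> where "w t = \<alpha> *\<^sub>R vector [1, 0, \<gamma> t $ 2 / 2] + \<beta> *\<^sub>R vector [0, 1, - (\<gamma> t $ 1) / 2]"
        using Ns[OF t] by (auto simp: span_insert span_singleton algebra_simps)
      then have "n \<bullet> w t = w t $ 1 * (n \<bullet> hfield 1 0 (\<gamma> t)) + w t $ 2 * (n \<bullet> hfield 0 1 (\<gamma> t))"
        by (simp add: inner_heis algebra_simps)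
      also have "\<dots> \<le> s t * \<bar>n \<bullet> hfield 1 0 (\<gamma> t)\<bar> + s t * \<bar>n \<bullet> hfield 0 1 (\<gamma> t)\<bar>"
      proof (rule add_mono)
        show "w t $ 1 * (n \<bullet> hfield 1 0 (\<gamma> t)) \<le> s t * \<bar>n \<bullet> hfield 1 0 (\<gamma> t)\<bar>"
          using mult_right_mono[OF s1[of t], of "\<bar>n \<bullet> hfield 1 0 (\<gamma> t)\<bar>"]
            abs_ge_self[of "w t $ 1 * (n \<bullet> hfield 1 0 (\<gamma> t))"]
          by (simp only: abs_mult) linarith
        show "w t $ 2 * (n \<bullet> hfield 0 1 (\<gamma> t)) \<le> s t * \<bar>n \<bullet> hfield 0 1 (\<gamma> t)\<bar>"
          using mult_right_mono[OF s2[of t], of "\<bar>n \<bullet> hfield 0 1 (\<gamma> t)\<bar>"]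
            abs_ge_self[of "w t $ 2 * (n \<bullet> hfield 0 1 (\<gamma> t))"]
          by (simp only: abs_mult) linarith
      qed
      also have "\<dots> = (\<bar>n \<bullet> hfield 1 0 (\<gamma> t)\<bar> + \<bar>n \<bullet> hfield 0 1 (\<gamma> t)\<bar>) * s t"
        by (simp add: algebra_simps)
      also have "\<dots> \<le> A * s t"
      proof (rule mult_right_mono[OF _ s0])
        have m1: "\<bar>\<gamma> t $ 1 - \<gamma> a $ 1\<bar> \<le> l" and m2: "\<bar>\<gamma> t $ 2 - \<gamma> a $ 2\<bar> \<le> l"
          using move[of t "axis 1 1"] move[of t "axis 2 1"] t s1 s2 by (simp_all add: inner_axis')
        have "n \<bullet> hfield 1 0 (\<gamma> t) = n \<bullet> hfield 1 0 (\<gamma> a) + n$3 * (\<gamma> t $ 2 - \<gamma> a $ 2) / 2"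
          "n \<bullet> hfield 0 1 (\<gamma> t) = n \<bullet> hfield 0 1 (\<gamma> a) - n$3 * (\<gamma> t $ 1 - \<gamma> a $ 1) / 2"
          by (simp_all add: inner_heis field_simps)
        moreover have "\<bar>n$3 * (\<gamma> t $ 2 - \<gamma> a $ 2)\<bar> \<le> \<bar>n$3\<bar> * l" "\<bar>n$3 * (\<gamma> t $ 1 - \<gamma> a $ 1)\<bar> \<le> \<bar>n$3\<bar> * l"
          using m1 m2 by (auto simp: abs_mult intro!: mult_left_mono)
        ultimately show "\<bar>n \<bullet> hfield 1 0 (\<gamma> t)\<bar> + \<bar>n \<bullet> hfield 0 1 (\<gamma> t)\<bar> \<le> A"
          unfolding A_def by linarith
      qed
      finally show ?thesis .
    qed
    have "A \<ge> 0" using \<open>l \<ge> 0\<close> by (simp add: A_def)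
    have "((\<lambda>t. if t \<in> N then 0 else n \<bullet> w t) has_integral (n \<bullet> \<gamma> b - n \<bullet> \<gamma> a)) {a..b}"
      by (rule fundamental_theorem_of_calculus_lipschitz[OF \<open>a \<le> b\<close> lip N]) (use der in auto)
    moreover have "((\<lambda>t. A * s t) has_integral (A * l)) {a..b}"
      unfolding l using s_int by (intro has_integral_mult_right) auto
    ultimately have "n \<bullet> \<gamma> b - n \<bullet> \<gamma> a \<le> A * l"
      by (rule has_integral_le) (use slope s0 \<open>A \<ge> 0\<close> in auto)
    then show ?thesis by (simp add: A_def algebra_simps power2_eq_square)
  qed
qed

text \<open>
  Connectivity, needed because the infimum of the empty set is an unspecified real number. The first two
  coordinates \<open>g1\<close>, \<open>g2\<close> are the linear interpolations plus \<open>t (1 - t)\<close> and \<open>b t (1 - t) (1 - 2 t)\<close>.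
  In the integral of \<open>g1' g2 - g2' g1\<close>, which is twice the increment of the third coordinate, the
  parameter \<open>b\<close> appears only as \<open>b / 15\<close>, so it can be chosen to reach the prescribed end point.
\<close>
lemma horizontal_curve_exists:
  fixes x y :: heis
  obtains \<gamma> where "horizontal_curve 0 1 \<gamma>" "\<gamma> 0 = x" "\<gamma> 1 = y"
proof -
  define p where "p = y$1 - x$1 + 1"
  define b where "b = 15 * (2 * (y$3 - x$3) - (y$1 - x$1) * x$2 + (y$2 - x$2) * x$1 + (y$2 - x$2) / 3)"
  define q where "q = y$2 - x$2 + b"
  define g1 where "g1 = (\<lambda>t::real. x$1 + p * t - t^2)"
  define g2 where "g2 = (\<lambda>t::real. x$2 + q * t - 3 * b * t^2 + 2 * b * t^3)"
  define d1 where "d1 = (\<lambda>t::real. p - 2 * t)"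
  define d2 where "d2 = (\<lambda>t::real. q - 6 * b * t + 6 * b * t^2)"
  define e0 where "e0 = p * x$2 - q * x$1"
  define e1 where "e1 = 6 * b * x$1 - 2 * x$2"
  define e2 where "e2 = 3 * b * p - q - 6 * b * x$1"
  define g3 where "g3 = (\<lambda>t::real. x$3 + (e0 / 2) * t + (e1 / 4) * t^2 + (e2 / 6) * t^3 - (b * p / 2) * t^4 + (b / 5) * t^5)"
  define \<gamma> where "\<gamma> = (\<lambda>t. vector [g1 t, g2 t, g3 t] :: heis)"
  define w where "w = (\<lambda>t. vector [d1 t, d2 t, (d1 t * g2 t - d2 t * g1 t) / 2] :: heis)"
  have der1: "(g1 has_vector_derivative d1 t) (at t)" for t
    unfolding g1_def d1_def has_real_derivative_iff_has_vector_derivative[symmetric]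
    by (rule derivative_eq_intros refl)+ simp
  have der2: "(g2 has_vector_derivative d2 t) (at t)" for t
    unfolding g2_def d2_def has_real_derivative_iff_has_vector_derivative[symmetric]
    by (rule derivative_eq_intros refl)+ simp
  have "(g3 has_real_derivative e0 / 2 + (e1 / 2) * t + (e2 / 2) * t^2 - (2 * b * p) * t^3 + b * t^4) (at t)" for t
    unfolding g3_def by (rule derivative_eq_intros refl)+ simp
  moreover have "e0 / 2 + (e1 / 2) * t + (e2 / 2) * t^2 - (2 * b * p) * t^3 + b * t^4 = (d1 t * g2 t - d2 t * g1 t) / 2" for t
  proof -
    have "e0 + e1 * t + e2 * t^2 - 4 * b * p * t^3 + 2 * b * t^4 = d1 t * g2 t - d2 t * g1 t"
      unfolding e0_def e1_def e2_def d1_def d2_def g1_def g2_def by algebra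
    then show ?thesis by (simp add: field_simps)
  qed
  ultimately have der3: "(g3 has_vector_derivative (d1 t * g2 t - d2 t * g1 t) / 2) (at t)" for t
    by (simp only: has_real_derivative_iff_has_vector_derivative)
  have \<gamma>_eq: "\<gamma> = (\<lambda>t. g1 t *\<^sub>R axis 1 1 + g2 t *\<^sub>R axis 2 1 + g3 t *\<^sub>R axis 3 1)"
    by (auto simp: \<gamma>_def vec_eq_iff forall_3 axis_def)
  have w_eq: "w = (\<lambda>t. d1 t *\<^sub>R axis 1 1 + d2 t *\<^sub>R axis 2 1 + ((d1 t * g2 t - d2 t * g1 t) / 2) *\<^sub>R axis 3 1)"
    by (auto simp: w_def vec_eq_iff forall_3 axis_def)
  have der: "(\<gamma> has_vector_derivative w t) (at t within S)" for t S
  proof -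
    have s: "((\<lambda>t. g t *\<^sub>R e) has_vector_derivative d *\<^sub>R e) (at t)"
      if "(g has_vector_derivative d) (at t)" for g :: "real \<Rightarrow> real" and d and e :: heis
      using that by (rule bounded_linear.has_vector_derivative[OF bounded_linear_scaleR_left])
    show ?thesis
      unfolding \<gamma>_eq w_eq
      by (rule has_vector_derivative_at_within)
         (rule has_vector_derivative_add[OF has_vector_derivative_add[OF s[OF der1] s[OF der2]] s[OF der3]])
  qed
  have cont: "continuous_on {0..1} w"
  proof -
    have "continuous_on {0..1} d1" "continuous_on {0..1} d2" "continuous_on {0..1} g1" "continuous_on {0..1} g2"
      unfolding d1_def d2_def g1_def g2_def by (intro continuous_intros)+
    then show ?thesis
      unfolding w_eq
      by (intro continuous_on_add continuous_on_scaleR continuous_on_divide continuous_on_diff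
          continuous_on_mult continuous_on_const) simp_all
  qed
  have "bounded (w ` {0..1})"
    by (intro compact_imp_bounded compact_continuous_image cont compact_Icc)
  then obtain B where B: "\<And>t. t \<in> {0..1} \<Longrightarrow> norm (w t) \<le> B"
    unfolding bounded_iff by blast
  have "\<exists>L. L-lipschitz_on {0..1} \<gamma>"
  proof (intro exI bounded_derivative_imp_lipschitz)
    show "(\<gamma> has_derivative (\<lambda>h. h *\<^sub>R w t)) (at t within {0..1})" if "t \<in> {0..1}" for t
      using der[of t "{0..1}"] by (simp add: has_vector_derivative_def)
    show "onorm (\<lambda>h. h *\<^sub>R w t) \<le> B" if "t \<in> {0..1}" for t
      using B[OF that] by (simp add: onorm_scaleR_left bounded_linear_ident onorm_id)
    show "0 \<le> B" using order_trans[OF norm_ge_zero B[of 0]] by simp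
  qed auto
  moreover have "\<gamma> differentiable (at t within {0..1}) \<and>
        vector_derivative \<gamma> (at t within {0..1})
          \<in> span {vector [1, 0, \<gamma> t $ 2 / 2], vector [0, 1, - (\<gamma> t $ 1) / 2]}"
    if t: "t \<in> {0..1}" for t
  proof
    show "\<gamma> differentiable (at t within {0..1})"
      using der by (rule differentiableI_vector)
    have "vector_derivative \<gamma> (at t within {0..1}) = w t"
      using t der by (intro vector_derivative_within_cbox[of 0 1, simplified]) auto
    also have "w t = d1 t *\<^sub>R vector [1, 0, \<gamma> t $ 2 / 2] + d2 t *\<^sub>R vector [0, 1, - (\<gamma> t $ 1) / 2]"
      by (simp add: w_def \<gamma>_def vec_eq_iff forall_3 diff_divide_distrib)
    also have "\<dots> \<in> span {vector [1, 0, \<gamma> t $ 2 / 2], vector [0, 1, - (\<gamma> t $ 1) / 2]}"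
      by (intro span_add span_scale span_base) auto
    finally show "vector_derivative \<gamma> (at t within {0..1})
          \<in> span {vector [1, 0, \<gamma> t $ 2 / 2], vector [0, 1, - (\<gamma> t $ 1) / 2]}" .
  qed
  ultimately have "horizontal_curve 0 1 \<gamma>"
    unfolding horizontal_curve_def by auto
  moreover have "\<gamma> 0 = x" "\<gamma> 1 = y"
    by (simp_all add: \<gamma>_def vec_eq_iff forall_3 g1_def g2_def g3_def e0_def e1_def e2_def p_def q_def b_def field_simps)
  ultimately show ?thesis using that by blast
qed

section \<open>Test functions and Hardy inequalities along the flow\<close>

definition hderiv :: "real \<Rightarrow> real \<Rightarrow> (heis \<Rightarrow> complex) \<Rightarrow> heis \<Rightarrow> complex" where
  "hderiv p q u x = p *\<^sub>R X1 u x + q *\<^sub>R X2 u x"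

lemma test_function_derivative:
  assumes "u \<in> test_functions \<Omega>"
  shows "(u has_derivative frechet_derivative u (at x)) (at x)"
proof -
  have "C_k_on 1 UNIV u"
    using assms unfolding test_functions_def smooth_on_def by blast
  then show ?thesis
    by (simp add: frechet_derivative_works)
qed

lemma frechet_derivative_hfield:
  assumes "u \<in> test_functions \<Omega>"
  shows "frechet_derivative u (at x) (hfield p q x) = hderiv p q u x"
proof -
  let ?D = "frechet_derivative u (at x)" and ?r = "(p * x$2 - q * x$1) / 2"
  have lin: "linear ?D"
    using test_function_derivative[OF assms] by (rule has_derivative_linear)
  have "hfield p q x = p *\<^sub>R axis 1 1 + q *\<^sub>R axis 2 1 + ?r *\<^sub>R axis 3 1"
    by (simp add: vec_eq_iff forall_3 axis_def)
  then have "?D (hfield p q x) = p *\<^sub>R ?D (axis 1 1) + q *\<^sub>R ?D (axis 2 1) + ?r *\<^sub>R ?D (axis 3 1)"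
    by (simp only: linear_add[OF lin] linear_scale[OF lin])
  also have "\<dots> = hderiv p q u x"
    by (simp add: hderiv_def X1_def X2_def pderiv_at_def
        scaleR_add_right scaleR_diff_right scaleR_diff_left diff_divide_distrib)
  finally show ?thesis .
qed

lemma continuous_on_test_function:
  assumes "u \<in> test_functions \<Omega>"
  shows "continuous_on S u" "continuous_on S (X1 u)" "continuous_on S (X2 u)" "continuous_on S (hderiv p q u)"
proof -
  have "C_k_on (Suc 0) UNIV u"
    using assms unfolding test_functions_def smooth_on_def by blast
  moreover have "axis i 1 \<in> (Basis :: heis set)" for i
    by (simp add: axis_in_Basis_iff)
  ultimately have "continuous_on UNIV (pderiv_at i u)" for i
    unfolding C_k_on.simps pderiv_at_def[abs_def] by blast
  then have pd: "continuous_on S (pderiv_at i u)" for i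
    using continuous_on_subset by blast
  show "continuous_on S u"
    by (meson test_function_derivative[OF assms] has_derivative_continuous continuous_at_imp_continuous_on)
  show 1: "continuous_on S (X1 u)" and 2: "continuous_on S (X2 u)"
    unfolding X1_def[abs_def] X2_def[abs_def] by (intro continuous_intros pd; simp)+
  show "continuous_on S (hderiv p q u)"
    unfolding hderiv_def[abs_def] by (intro continuous_intros 1 2)
qed

lemma test_function_zero:
  assumes "u \<in> test_functions \<Omega>" "x \<notin> closure {x. u x \<noteq> 0}"
  shows "u x = 0" "X1 u x = 0" "X2 u x = 0" "hderiv p q u x = 0"
proof -
  let ?K = "closure {x. u x \<noteq> 0}"
  have u0: "u y = 0" if "y \<notin> ?K" for y
    by (rule ccontr) (rule notE[OF that subsetD[OF closure_subset CollectI]])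
  show "u x = 0" by (rule u0[OF assms(2)])
  have "frechet_derivative u (at x) = (\<lambda>_. 0)"
  proof (rule has_derivative_unique[OF test_function_derivative[OF assms(1)]])
    show "(u has_derivative (\<lambda>_. 0)) (at x)"
    proof (rule has_derivative_transform_within_open)
      show "((\<lambda>_. 0) has_derivative (\<lambda>_. 0)) (at x)" by simp
      show "open (- ?K)" by (rule open_Compl[OF closed_closure])
      show "x \<in> - ?K" using assms(2) by blast
      show "0 = u y" if "y \<in> - ?K" for y by (rule u0[symmetric]) (rule ComplD[OF that])
    qed
  qed
  then show 1: "X1 u x = 0" and 2: "X2 u x = 0" by (simp_all add: X1_def X2_def pderiv_at_def)
  show "hderiv p q u x = 0" using 1 2 by (simp add: hderiv_def)
qed

lemma integrable_test_function:
  assumes u: "u \<in> test_functions \<Omega>" and g: "continuous_on \<Omega> g"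
    and v: "\<And>S. continuous_on S v" "\<And>x. x \<notin> closure {x. u x \<noteq> 0} \<Longrightarrow> v x = 0"
  shows "integrable lebesgue (\<lambda>x. g x * v x :: real)"
proof (rule integrable_lebesgue_compact_support)
  show "compact (closure {x. u x \<noteq> 0})"
    using u by (simp add: test_functions_def)
  have "closure {x. u x \<noteq> 0} \<subseteq> \<Omega>"
    using u by (simp add: test_functions_def)
  then show "continuous_on (closure {x. u x \<noteq> 0}) (\<lambda>x. g x * v x)"
    by (intro continuous_on_mult continuous_on_subset[OF g] v(1))
  show "g x * v x = 0" if "x \<notin> closure {x. u x \<noteq> 0}" for x
    using v(2)[OF that] by simp
qed

text \<open>
  The case \<open>f = \<bar>u\<bar>\<^sup>2\<close>, where the real part of \<open>cnj u\<close> times \<open>v\<close> is the inner product \<open>u \<bullet> v\<close>.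
\<close>
lemma one_sided_integration_by_parts:
  assumes "open \<Omega>" and u: "u \<in> test_functions \<Omega>"
    and h: "continuous_on \<Omega> h" and k: "continuous_on \<Omega> k"
    and "\<tau> > 0"
    and hk: "\<And>x t. x \<in> closure {x. u x \<noteq> 0} \<Longrightarrow> 0 < t \<Longrightarrow> t < \<tau> \<Longrightarrow> hflow p q t x \<in> \<Omega> \<Longrightarrow>
       t * k x - C * t\<^sup>2 \<le> h (hflow p q t x) - h x"
  shows "(\<integral>x. k x * (cmod (u x))\<^sup>2 \<partial>lebesgue) \<le> (\<integral>x. h x * (- 2 * (u x \<bullet> hderiv p q u x)) \<partial>lebesgue)"
proof -
  let ?f' = "\<lambda>x v. 2 * (u x \<bullet> frechet_derivative u (at x) v)"
  have f': "?f' x (hfield p q x) = 2 * (u x \<bullet> hderiv p q u x)" for x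
    by (simp add: frechet_derivative_hfield[OF u])
  have "(\<integral>x. k x * (u x \<bullet> u x) \<partial>lebesgue) \<le> - (\<integral>x. h x * ?f' x (hfield p q x) \<partial>lebesgue)"
  proof (rule integration_by_parts_along_hflow[OF \<open>open \<Omega>\<close> _ _ _ _ _ _ h k \<open>\<tau> > 0\<close> hk])
    show "((\<lambda>x. u x \<bullet> u x) has_derivative ?f' x) (at x)" for x
      by (rule has_derivative_eq_rhs[OF has_derivative_inner[OF test_function_derivative[OF u] test_function_derivative[OF u]]])
         (auto simp: inner_commute)
    show "continuous_on UNIV (\<lambda>x. ?f' x (hfield p q x))"
      unfolding f' by (intro continuous_intros continuous_on_test_function[OF u])
    show "compact (closure {x. u x \<noteq> 0})" "closure {x. u x \<noteq> 0} \<subseteq> \<Omega>"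
      using u by (auto simp: test_functions_def)
    show "0 \<le> u x \<bullet> u x" for x by simp
    show "u x \<bullet> u x = 0" if "x \<notin> closure {x. u x \<noteq> 0}" for x
      using test_function_zero(1)[OF u that] by simp
  qed
  also have "\<dots> = (\<integral>x. h x * (- 2 * (u x \<bullet> hderiv p q u x)) \<partial>lebesgue)"
    unfolding f' integral_minus[symmetric] by (intro Bochner_Integration.integral_cong) auto
  finally show ?thesis by (simp add: power2_norm_eq_inner)
qed

text \<open>
  The one-dimensional Hardy inequality in the form that uses only the differential inequality
  \<open>h' \<ge> h\<^sup>2\<close> along the flow, satisfied by the reciprocal of a distance to an end point. Integration by
  parts bounds the left-hand side by the integral of \<open>2 h \<bar>u\<bar> \<bar>V u\<bar> \<le> h\<^sup>2 \<bar>u\<bar>\<^sup>2 / 2 + 2 \<bar>V u\<bar>\<^sup>2\<close>, and the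
  first term is absorbed.
\<close>
lemma riccati_hardy:
  assumes "open \<Omega>" and u: "u \<in> test_functions \<Omega>"
    and h: "continuous_on \<Omega> h"
    and hh: "\<And>x t. x \<in> \<Omega> \<Longrightarrow> 0 < t \<Longrightarrow> hflow p q t x \<in> \<Omega> \<Longrightarrow>
       t * (h x)\<^sup>2 \<le> h (hflow p q t x) - h x"
  shows "(\<integral>x. (h x)\<^sup>2 * (cmod (u x))\<^sup>2 \<partial>lebesgue) \<le> 4 * (\<integral>x. (cmod (hderiv p q u x))\<^sup>2 \<partial>lebesgue)"
proof -
  note cont = continuous_on_test_function[OF u]
  note int = integrable_test_function[OF u]
  have zero: "(cmod (u x))\<^sup>2 = 0" "(cmod (hderiv p q u x))\<^sup>2 = 0" "- 2 * (u x \<bullet> hderiv p q u x) = 0"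
    if "x \<notin> closure {x. u x \<noteq> 0}" for x
    using test_function_zero(1,4)[OF u that] by simp_all
  have i1: "integrable lebesgue (\<lambda>x. (h x)\<^sup>2 * (cmod (u x))\<^sup>2)"
    by (rule int) (intro continuous_intros h cont zero)+
  have i2: "integrable lebesgue (\<lambda>x. (cmod (hderiv p q u x))\<^sup>2)"
  proof -
    have "integrable lebesgue (\<lambda>x. 1 * (cmod (hderiv p q u x))\<^sup>2)"
      by (rule int) (intro continuous_intros cont zero)+
    then show ?thesis by simp
  qed
  have i3: "integrable lebesgue (\<lambda>x. h x * (- 2 * (u x \<bullet> hderiv p q u x)))"
    by (rule int) (intro continuous_intros h cont zero)+
  have "(\<integral>x. (h x)\<^sup>2 * (cmod (u x))\<^sup>2 \<partial>lebesgue) \<le> (\<integral>x. h x * (- 2 * (u x \<bullet> hderiv p q u x)) \<partial>lebesgue)"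
  proof (rule one_sided_integration_by_parts[OF \<open>open \<Omega>\<close> u h, where C=0 and \<tau>=1])
    show "continuous_on \<Omega> (\<lambda>x. (h x)\<^sup>2)" by (intro continuous_intros h)
    show "t * (h x)\<^sup>2 - 0 * t\<^sup>2 \<le> h (hflow p q t x) - h x"
      if "x \<in> closure {x. u x \<noteq> 0}" "0 < t" "hflow p q t x \<in> \<Omega>" for x t
    proof -
      have "x \<in> \<Omega>" using u that(1) unfolding test_functions_def by blast
      then show ?thesis using hh[of x t] that by simp
    qed
  qed simp
  also have "\<dots> \<le> (\<integral>x. 1/2 * ((h x)\<^sup>2 * (cmod (u x))\<^sup>2) + 2 * (cmod (hderiv p q u x))\<^sup>2 \<partial>lebesgue)"
  proof (intro integral_mono i3 Bochner_Integration.integrable_add integrable_mult_right i1 i2)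
    fix x
    have "h x * (- 2 * (u x \<bullet> hderiv p q u x)) \<le> 2 * (\<bar>h x\<bar> * cmod (u x)) * cmod (hderiv p q u x)"
    proof -
      have "h x * (- 2 * (u x \<bullet> hderiv p q u x)) \<le> \<bar>h x * (- 2 * (u x \<bullet> hderiv p q u x))\<bar>"
        by (rule abs_ge_self)
      also have "\<dots> = 2 * \<bar>h x\<bar> * \<bar>u x \<bullet> hderiv p q u x\<bar>"
        by (simp add: abs_mult)
      also have "\<dots> \<le> 2 * \<bar>h x\<bar> * (cmod (u x) * cmod (hderiv p q u x))"
        by (intro mult_left_mono Cauchy_Schwarz_ineq2) simp
      finally show ?thesis by (simp only: mult.assoc)
    qed
    also have "\<dots> \<le> 1/2 * (\<bar>h x\<bar> * cmod (u x))\<^sup>2 + 2 * (cmod (hderiv p q u x))\<^sup>2"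
      using zero_le_power2[of "\<bar>h x\<bar> * cmod (u x) - 2 * cmod (hderiv p q u x)"]
      by (simp add: power2_eq_square algebra_simps)
    finally show "h x * (- 2 * (u x \<bullet> hderiv p q u x))
       \<le> 1/2 * ((h x)\<^sup>2 * (cmod (u x))\<^sup>2) + 2 * (cmod (hderiv p q u x))\<^sup>2"
      by (simp add: power_mult_distrib)
  qed
  also have "\<dots> = 1/2 * (\<integral>x. (h x)\<^sup>2 * (cmod (u x))\<^sup>2 \<partial>lebesgue) + 2 * (\<integral>x. (cmod (hderiv p q u x))\<^sup>2 \<partial>lebesgue)"
    using i1 i2 by (subst Bochner_Integration.integral_add) auto
  finally show ?thesis by simp
qed

section \<open>Exit rates from an intersection of half-spaces\<close>

lemma inner_hflow: "n \<bullet> hflow p q t x = n \<bullet> x + t * (n \<bullet> hfield p q x)"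
  by (simp add: hflow_def inner_add_right)

text \<open>
  The reciprocal of the time at which the horizontal line through \<open>x\<close> in direction \<open>(p, q)\<close>
  leaves the intersection of the half-spaces \<open>n \<bullet> y < c\<close>; it is 0 if the line never leaves.
\<close>
definition exit_rate :: "(heis \<times> real) set \<Rightarrow> real \<Rightarrow> real \<Rightarrow> heis \<Rightarrow> real" where
  "exit_rate I p q x = Max (insert 0 ((\<lambda>(n, c). (n \<bullet> hfield p q x) / (c - n \<bullet> x)) ` I))"

lemma exit_rate_nonneg: "finite I \<Longrightarrow> 0 \<le> exit_rate I p q x"
  by (simp add: exit_rate_def)

lemma exit_rate_ge:
  assumes "finite I" "(n, c) \<in> I"
  shows "(n \<bullet> hfield p q x) / (c - n \<bullet> x) \<le> exit_rate I p q x"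
  unfolding exit_rate_def using assms by (intro Max_ge) force+

lemma continuous_on_Max_insert:
  fixes f :: "'i \<Rightarrow> 'a::topological_space \<Rightarrow> real"
  assumes "finite I" "\<And>i. i \<in> I \<Longrightarrow> continuous_on S (f i)"
  shows "continuous_on S (\<lambda>x. Max (insert 0 ((\<lambda>i. f i x) ` I)))"
  using assms
proof (induction I rule: finite_induct)
  case (insert i I)
  have "Max (insert 0 ((\<lambda>i. f i x) ` insert i I)) = max (f i x) (Max (insert 0 ((\<lambda>i. f i x) ` I)))" for x
    using insert.hyps by (simp add: insert_commute[of 0])
  then show ?case using insert by (auto intro!: continuous_intros)
qed simp

text \<open>
  The exit time decreases with unit speed along the flow. In terms of the active half-space, the rate
  \<open>r\<close> becomes \<open>r / (1 - t r) \<ge> r + t r\<^sup>2\<close>; passing to the maximum only helps.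
\<close>
lemma exit_rate_increase:
  assumes "finite I" and x: "\<And>n c. (n, c) \<in> I \<Longrightarrow> n \<bullet> x < c"
    and tx: "\<And>n c. (n, c) \<in> I \<Longrightarrow> n \<bullet> hflow p q t x < c" and "0 < t"
  shows "t * (exit_rate I p q x)\<^sup>2 \<le> exit_rate I p q (hflow p q t x) - exit_rate I p q x"
proof -
  have "exit_rate I p q x \<in> insert 0 ((\<lambda>(n, c). (n \<bullet> hfield p q x) / (c - n \<bullet> x)) ` I)"
    unfolding exit_rate_def using assms by (intro Max_in) auto
  then consider "exit_rate I p q x = 0"
    | n c where "(n, c) \<in> I" "exit_rate I p q x = (n \<bullet> hfield p q x) / (c - n \<bullet> x)" by auto
  then show ?thesis
  proof cases
    case 1
    then show ?thesis using exit_rate_nonneg[OF assms(1)] by simp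
  next
    case 2
    define r where "r = exit_rate I p q x"
    define d where "d = c - n \<bullet> x"
    have "d > 0" using x[OF 2(1)] by (simp add: d_def)
    have V: "n \<bullet> hfield p q x = r * d" using 2(2) \<open>d > 0\<close> by (simp add: r_def d_def)
    have d': "c - n \<bullet> hflow p q t x = d * (1 - t * r)"
    proof -
      have "c - n \<bullet> hflow p q t x = d - t * (n \<bullet> hfield p q x)"
        by (simp add: inner_hflow d_def)
      then show ?thesis by (simp add: V algebra_simps)
    qed
    have pos: "1 - t * r > 0"
      using tx[OF 2(1)] \<open>d > 0\<close> d' by (metis diff_gt_0_iff_gt zero_less_mult_pos)
    have "r \<ge> 0" using exit_rate_nonneg[OF assms(1)] by (simp add: r_def)
    have "r + t * r\<^sup>2 \<le> r / (1 - t * r)"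
    proof -
      have "(r + t * r\<^sup>2) * (1 - t * r) = r - t\<^sup>2 * r ^ 3" 
        by (simp add: algebra_simps power2_eq_square power3_eq_cube)
      also have "\<dots> \<le> r" using \<open>r \<ge> 0\<close> by simp
      finally show ?thesis using pos by (simp add: le_divide_eq)
    qed
    also have "r / (1 - t * r) = (n \<bullet> hfield p q (hflow p q t x)) / (c - n \<bullet> hflow p q t x)"
      using \<open>d > 0\<close> by (simp add: d' V)
    also have "\<dots> \<le> exit_rate I p q (hflow p q t x)"
      by (rule exit_rate_ge[OF assms(1) 2(1)])
    finally show ?thesis by (simp add: r_def)
  qed
qed

lemma continuous_on_exit_rate:
  assumes "finite I" "\<And>n c x. (n, c) \<in> I \<Longrightarrow> x \<in> S \<Longrightarrow> n \<bullet> x < c"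
  shows "continuous_on S (exit_rate I p q)"
  unfolding exit_rate_def[abs_def]
proof (rule continuous_on_Max_insert[OF assms(1)])
  fix i assume "i \<in> I"
  then show "continuous_on S (\<lambda>x. case i of (n, c) \<Rightarrow> (n \<bullet> hfield p q x) / (c - n \<bullet> x))"
    using assms(2) by (cases i) (force intro!: continuous_intros)
qed

lemma hardy_exit_rate:
  assumes "open \<Omega>" and u: "u \<in> test_functions \<Omega>"
    and I: "finite I" "\<And>n c x. (n, c) \<in> I \<Longrightarrow> x \<in> \<Omega> \<Longrightarrow> n \<bullet> x < c"
  shows "(\<integral>x. (exit_rate I p q x)\<^sup>2 * (cmod (u x))\<^sup>2 \<partial>lebesgue) \<le> 4 * (\<integral>x. (cmod (hderiv p q u x))\<^sup>2 \<partial>lebesgue)"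
  by (rule riccati_hardy[OF assms(1,2) continuous_on_exit_rate[OF I]])
     (use I in \<open>auto intro!: exit_rate_increase\<close>)

section \<open>The weight of a non-vertical plane\<close>

definition horizontal_energy :: "(heis \<Rightarrow> complex) \<Rightarrow> real" where
  "horizontal_energy u = (\<integral>x. (subgradient_norm u x)\<^sup>2 \<partial>lebesgue)"

lemma horizontal_energy_eq:
  assumes u: "u \<in> test_functions \<Omega>"
  shows "integrable lebesgue (\<lambda>x. (cmod (X1 u x))\<^sup>2)" "integrable lebesgue (\<lambda>x. (cmod (X2 u x))\<^sup>2)"
    "horizontal_energy u = (\<integral>x. (cmod (X1 u x))\<^sup>2 \<partial>lebesgue) + (\<integral>x. (cmod (X2 u x))\<^sup>2 \<partial>lebesgue)"
proof -
  note int = integrable_test_function[OF u continuous_on_const[of \<Omega> 1]]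
  have zero: "(cmod (X1 u x))\<^sup>2 = 0" "(cmod (X2 u x))\<^sup>2 = 0"
    if "x \<notin> closure {x. u x \<noteq> 0}" for x
    using test_function_zero(2,3)[OF u that] by simp_all
  have "integrable lebesgue (\<lambda>x. 1 * (cmod (X1 u x))\<^sup>2)"
    by (rule int) (intro continuous_intros continuous_on_test_function[OF u] zero)+
  moreover have "integrable lebesgue (\<lambda>x. 1 * (cmod (X2 u x))\<^sup>2)"
    by (rule int) (intro continuous_intros continuous_on_test_function[OF u] zero)+
  ultimately show i: "integrable lebesgue (\<lambda>x. (cmod (X1 u x))\<^sup>2)" "integrable lebesgue (\<lambda>x. (cmod (X2 u x))\<^sup>2)"
    by simp_all
  show "horizontal_energy u = (\<integral>x. (cmod (X1 u x))\<^sup>2 \<partial>lebesgue) + (\<integral>x. (cmod (X2 u x))\<^sup>2 \<partial>lebesgue)"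
    unfolding horizontal_energy_def subgradient_norm_def
    using i by (simp flip: Bochner_Integration.integral_add)
qed

text \<open>
  Summing over the four directions \<open>\<plusminus>X1\<close>, \<open>\<plusminus>X2\<close> dominates the squared slope over the squared height
  for every face at once. As the rates are maxima over the faces, the resulting
  Hardy inequality has a constant independent of their number.
\<close>
definition exit_weight :: "(heis \<times> real) set \<Rightarrow> heis \<Rightarrow> real" where
  "exit_weight I x = (exit_rate I 1 0 x)\<^sup>2 + (exit_rate I (-1) 0 x)\<^sup>2
     + (exit_rate I 0 1 x)\<^sup>2 + (exit_rate I 0 (-1) x)\<^sup>2"

lemma exit_weight_nonneg: "0 \<le> exit_weight I x"
  by (simp add: exit_weight_def)

lemma square_le_exit_rates:
  assumes "finite I" "(n, c) \<in> I"
  shows "((n \<bullet> hfield p q x) / (c - n \<bullet> x))\<^sup>2 \<le> (exit_rate I p q x)\<^sup>2 + (exit_rate I (-p) (-q) x)\<^sup>2"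
proof -
  define r where "r = (n \<bullet> hfield p q x) / (c - n \<bullet> x)"
  have "n \<bullet> hfield (-p) (-q) x = - (n \<bullet> hfield p q x)"
    by (simp add: inner_heis algebra_simps flip: add_divide_distrib)
  then have 1: "r \<le> exit_rate I p q x" "- r \<le> exit_rate I (-p) (-q) x"
    using exit_rate_ge[OF assms, of p q x] exit_rate_ge[OF assms, of "-p" "-q" x] by (simp_all add: r_def)
  have "r\<^sup>2 \<le> (exit_rate I p q x)\<^sup>2 + (exit_rate I (-p) (-q) x)\<^sup>2"
  proof (cases "r \<ge> 0")
    case True
    then have "r\<^sup>2 \<le> (exit_rate I p q x)\<^sup>2" using 1 by (intro power_mono)
    then show ?thesis by (simp add: add_increasing2)
  next
    case False
    then have "(- r)\<^sup>2 \<le> (exit_rate I (-p) (-q) x)\<^sup>2" using 1 by (intro power_mono) auto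
    then show ?thesis by (simp add: add_increasing)
  qed
  then show ?thesis by (simp add: r_def)
qed

lemma slopes_le_exit_weight:
  assumes "finite I" "(n, c) \<in> I"
  shows "((n \<bullet> hfield 1 0 x) / (c - n \<bullet> x))\<^sup>2 + ((n \<bullet> hfield 0 1 x) / (c - n \<bullet> x))\<^sup>2 \<le> exit_weight I x"
  using square_le_exit_rates[OF assms, of 1 0 x] square_le_exit_rates[OF assms, of 0 1 x]
  by (simp add: exit_weight_def)

lemma continuous_on_exit_weight:
  assumes "finite I" "\<And>n c x. (n, c) \<in> I \<Longrightarrow> x \<in> S \<Longrightarrow> n \<bullet> x < c"
  shows "continuous_on S (exit_weight I)"
  unfolding exit_weight_def[abs_def]
  by (intro continuous_on_add continuous_on_power continuous_on_exit_rate assms)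

lemma integrable_weight:
  assumes u: "u \<in> test_functions \<Omega>" and "continuous_on \<Omega> g"
  shows "integrable lebesgue (\<lambda>x. g x * (cmod (u x))\<^sup>2)"
proof (rule integrable_test_function[OF u assms(2)])
  show "continuous_on S (\<lambda>x. (cmod (u x))\<^sup>2)" for S
    by (intro continuous_intros continuous_on_test_function[OF u])
  show "(cmod (u x))\<^sup>2 = 0" if "x \<notin> closure {x. u x \<noteq> 0}" for x
    using test_function_zero(1)[OF u that] by simp
qed

lemma hardy_exit_weight:
  assumes "open \<Omega>" and u: "u \<in> test_functions \<Omega>"
    and I: "finite I" "\<And>n c x. (n, c) \<in> I \<Longrightarrow> x \<in> \<Omega> \<Longrightarrow> n \<bullet> x < c"
  shows "(\<integral>x. exit_weight I x * (cmod (u x))\<^sup>2 \<partial>lebesgue) \<le> 8 * horizontal_energy u"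
proof -
  let ?J = "\<lambda>p q. \<integral>x. (exit_rate I p q x)\<^sup>2 * (cmod (u x))\<^sup>2 \<partial>lebesgue"
  have int: "integrable lebesgue (\<lambda>x. (exit_rate I p q x)\<^sup>2 * (cmod (u x))\<^sup>2)" for p q
    by (intro integrable_weight[OF u] continuous_on_power continuous_on_exit_rate I)
  have "(\<integral>x. exit_weight I x * (cmod (u x))\<^sup>2 \<partial>lebesgue) = ?J 1 0 + ?J (-1) 0 + ?J 0 1 + ?J 0 (-1)"
    unfolding exit_weight_def distrib_right
    by (simp only: Bochner_Integration.integral_add Bochner_Integration.integrable_add int)
  also have "\<dots> \<le> 8 * horizontal_energy u"
    using hardy_exit_rate[OF assms(1,2) I, of 1 0] hardy_exit_rate[OF assms(1,2) I, of "-1" 0]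
      hardy_exit_rate[OF assms(1,2) I, of 0 1] hardy_exit_rate[OF assms(1,2) I, of 0 "-1"]
    by (simp add: hderiv_def horizontal_energy_eq[OF u])
  finally show ?thesis .
qed

text \<open>
  Over the characteristic point of a plane both slopes vanish, and the slope weight is useless. In coordinates
  of the group centred at that point, with \<open>x3\<close> the height over the plane, the remedy is the horizontal
  field \<open>(x1, x2) / x3\<close>: as the radial field does not see \<open>x3\<close>, its horizontal divergence is \<open>2 / x3\<close>.
  Up to a factor it is \<open>(- n \<bullet> X2, n \<bullet> X1)\<close> over the height; the lemma treats its component
  in the direction \<open>(p, q)\<close>, and \<open>(-q, p)\<close> is that direction turned by a right angle.
\<close>
lemma rotated_slope_integration_by_parts:
  fixes n :: heis and c p q s :: real
  assumes "open \<Omega>" and u: "u \<in> test_functions \<Omega>"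
    and half: "\<forall>x\<in>\<Omega>. n \<bullet> x < c" and pq: "p\<^sup>2 + q\<^sup>2 = 1"
    and h_def: "h = (\<lambda>x. - s * (n \<bullet> hfield (-q) p x) / (c - n \<bullet> x))"
    and k_def: "k = (\<lambda>x. s * (n$3 / 2 * (c - n \<bullet> x) - (n \<bullet> hfield p q x) * (n \<bullet> hfield (-q) p x)) / (c - n \<bullet> x)\<^sup>2)"
  shows "continuous_on \<Omega> h" "continuous_on \<Omega> k"
    and "(\<integral>x. k x * (cmod (u x))\<^sup>2 \<partial>lebesgue) \<le> (\<integral>x. h x * (- 2 * (u x \<bullet> hderiv p q u x)) \<partial>lebesgue)"
proof -
  let ?K = "closure {x. u x \<noteq> 0}"
  have K: "compact ?K" "?K \<subseteq> \<Omega>"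
    using u by (simp_all add: test_functions_def)
  have ne: "c - n \<bullet> x \<noteq> 0" if "x \<in> \<Omega>" for x using bspec[OF half that] by simp
  show h: "continuous_on \<Omega> h" and k: "continuous_on \<Omega> k"
    unfolding h_def k_def using ne by (auto intro!: continuous_intros)
  have bdd: "\<exists>B>0. \<forall>x\<in>?K. \<bar>g x\<bar> \<le> B" if "continuous_on \<Omega> g" for g :: "heis \<Rightarrow> real"
    using compact_imp_bounded[OF compact_continuous_image[OF continuous_on_subset[OF that K(2)] K(1)]]
    unfolding bounded_pos by auto
  (* B keeps the height above half its initial value up to time 1 / (2 * B); C then bounds the second-order
     remainder of the difference quotient of h. *)
  have "continuous_on \<Omega> (\<lambda>x. (n \<bullet> hfield p q x) / (c - n \<bullet> x))"
    using ne by (auto intro!: continuous_intros)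
  from bdd[OF this] obtain B where "B > 0" and B: "\<And>x. x \<in> ?K \<Longrightarrow> \<bar>(n \<bullet> hfield p q x) / (c - n \<bullet> x)\<bar> \<le> B"
    by blast
  have "continuous_on \<Omega> (\<lambda>x. 2 * k x * (n \<bullet> hfield p q x) / (c - n \<bullet> x))"
    using ne by (auto intro!: continuous_intros k)
  from bdd[OF this] obtain C where C: "\<And>x. x \<in> ?K \<Longrightarrow> \<bar>2 * k x * (n \<bullet> hfield p q x) / (c - n \<bullet> x)\<bar> \<le> C"
    by blast
  show "(\<integral>x. k x * (cmod (u x))\<^sup>2 \<partial>lebesgue) \<le> (\<integral>x. h x * (- 2 * (u x \<bullet> hderiv p q u x)) \<partial>lebesgue)"
  proof (rule one_sided_integration_by_parts[OF \<open>open \<Omega>\<close> u h k, where \<tau> = "1 / (2 * B)" and C = C])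
    show "1 / (2 * B) > 0" using \<open>B > 0\<close> by simp
    fix x t
    assume x: "x \<in> ?K" and t: "0 < t" "t < 1 / (2 * B)"
    define d where "d = c - n \<bullet> x"
    define P where "P = n \<bullet> hfield p q x"
    define R where "R = n \<bullet> hfield (-q) p x"
    define d' where "d' = c - n \<bullet> hflow p q t x"
    have "d > 0" using bspec[OF half subsetD[OF K(2) x]] by (simp add: d_def)
    have d': "d' = d - t * P"
      by (simp add: d'_def d_def P_def inner_hflow)
    have "t * B \<le> 1 / 2" using t \<open>B > 0\<close> by (simp add: field_simps)
    have "\<bar>P\<bar> \<le> B * d" using B[OF x] \<open>d > 0\<close> by (simp add: P_def d_def abs_divide divide_le_eq)
    then have "t * \<bar>P\<bar> \<le> t * (B * d)" using t by (intro mult_left_mono) auto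
    also have "\<dots> \<le> d / 2" using mult_right_mono[OF \<open>t * B \<le> 1 / 2\<close>, of d] \<open>d > 0\<close> by simp
    finally have "t * \<bar>P\<bar> \<le> d / 2" .
    moreover have "t * P \<le> t * \<bar>P\<bar>" using t by (intro mult_left_mono) auto
    ultimately have "d' \<ge> d / 2" unfolding d' by linarith
    have "n \<bullet> hfield (-q) p (hflow p q t x) = R - n$3 * t / 2 * (p\<^sup>2 + q\<^sup>2)"
      by (simp add: R_def inner_heis field_simps power2_eq_square)
    then have R': "n \<bullet> hfield (-q) p (hflow p q t x) = R - n$3 * t / 2"
      using pq by simp
    have kx: "k x = s * (n$3 / 2 * d - P * R) / d\<^sup>2"
      by (simp add: k_def d_def P_def R_def)
    have "h (hflow p q t x) - h x = - s * (R - n$3 * t / 2) / d' - (- s * R / d)"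
      unfolding h_def R' by (simp add: d'_def d_def R_def)
    also have "\<dots> = t * (s * (n$3 / 2 * d - P * R)) / (d * d')"
      using \<open>d > 0\<close> \<open>d' \<ge> d / 2\<close> by (simp add: d' field_simps)
    also have "\<dots> = t * k x + t\<^sup>2 * (k x * P / d')"
      using \<open>d > 0\<close> \<open>d' \<ge> d / 2\<close> unfolding kx
      by (simp add: divide_simps) (simp add: d' algebra_simps power2_eq_square)
    finally have eq: "h (hflow p q t x) - h x = t * k x + t\<^sup>2 * (k x * P / d')" .
    have "\<bar>k x * P / d'\<bar> \<le> \<bar>k x * P\<bar> / (d / 2)"
      unfolding abs_divide using \<open>d > 0\<close> \<open>d' \<ge> d / 2\<close> by (intro frac_le) auto
    also have "\<dots> = \<bar>2 * k x * P / d\<bar>" using \<open>d > 0\<close> by (simp add: abs_mult abs_divide)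
    also have "\<dots> \<le> C" using C[OF x] by (simp add: P_def d_def)
    finally have "- C \<le> k x * P / d'" by (simp only: abs_le_iff minus_le_iff)
    from mult_left_mono[OF this, of "t\<^sup>2"] show "t * k x - C * t\<^sup>2 \<le> h (hflow p q t x) - h x"
      unfolding eq by (simp add: mult.commute)
  qed
qed

text \<open>
  The two components of the rotated slope field have divergences adding up to \<open>\<bar>n3\<bar>\<close> over the height,
  and the square of the field is a slope weight, which is already controlled. The sign \<open>s\<close> orients the
  field so that its divergence is positive.
\<close>
lemma hardy_vertical_distance:
  assumes "open \<Omega>" and u: "u \<in> test_functions \<Omega>"
    and half: "\<forall>x\<in>\<Omega>. n \<bullet> x < c"
  shows "(\<integral>x. \<bar>n$3\<bar> / (c - n \<bullet> x) * (cmod (u x))\<^sup>2 \<partial>lebesgue) \<le> 9 * horizontal_energy u"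
proof -
  define s where "s = sgn (n$3)"
  have s: "s * n$3 = \<bar>n$3\<bar>" "s\<^sup>2 \<le> 1" by (auto simp: s_def sgn_if)
  define h1 where "h1 = (\<lambda>x. - s * (n \<bullet> hfield 0 1 x) / (c - n \<bullet> x))"
  define h2 where "h2 = (\<lambda>x. - s * (n \<bullet> hfield (-1) 0 x) / (c - n \<bullet> x))"
  define k1 where "k1 = (\<lambda>x. s * (n$3 / 2 * (c - n \<bullet> x) - (n \<bullet> hfield 1 0 x) * (n \<bullet> hfield 0 1 x)) / (c - n \<bullet> x)\<^sup>2)"
  define k2 where "k2 = (\<lambda>x. s * (n$3 / 2 * (c - n \<bullet> x) - (n \<bullet> hfield 0 1 x) * (n \<bullet> hfield (-1) 0 x)) / (c - n \<bullet> x)\<^sup>2)"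
  have one: "(1::real)\<^sup>2 + 0\<^sup>2 = 1" "(0::real)\<^sup>2 + 1\<^sup>2 = 1" by simp_all
  note ibp1 = rotated_slope_integration_by_parts[OF assms one(1), unfolded minus_zero, OF h1_def k1_def]
  note ibp2 = rotated_slope_integration_by_parts[OF assms one(2) h2_def k2_def]
  define I where "I = {(n, c)}"
  have I: "finite I" "(n, c) \<in> I" "\<And>n c x. (n, c) \<in> I \<Longrightarrow> x \<in> \<Omega> \<Longrightarrow> n \<bullet> x < c"
    using half by (auto simp: I_def)
  have neg: "n \<bullet> hfield (-1) 0 x = - (n \<bullet> hfield 1 0 x)" for x
    by (simp add: inner_heis)
  have pos: "c - n \<bullet> x > 0" if "x \<in> \<Omega>" for x using bspec[OF half that] by simp
  have ksum: "k1 x + k2 x = \<bar>n$3\<bar> / (c - n \<bullet> x)" if "x \<in> \<Omega>" for x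
  proof -
    have "k1 x + k2 x = s * n$3 * (c - n \<bullet> x) / (c - n \<bullet> x)\<^sup>2"
    proof -
      have num: "s * (a / 2 * d - P * R) + s * (a / 2 * d - R * (- P)) = s * a * d" for a d P R :: real
        by (simp add: field_simps)
      show ?thesis
        unfolding k1_def k2_def neg add_divide_distrib[symmetric] num ..
    qed
    then show ?thesis using pos[OF that] s by (simp add: power2_eq_square)
  qed
  have hsum: "(h1 x)\<^sup>2 + (h2 x)\<^sup>2 \<le> exit_weight I x" for x
  proof -
    let ?a = "(n \<bullet> hfield 0 1 x) / (c - n \<bullet> x)" and ?b = "(n \<bullet> hfield 1 0 x) / (c - n \<bullet> x)"
    have "h1 x = - s * ?a" "h2 x = s * ?b"
      unfolding h1_def h2_def neg by simp_all
    then have "(h1 x)\<^sup>2 + (h2 x)\<^sup>2 = s\<^sup>2 * (?a\<^sup>2 + ?b\<^sup>2)"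
      by (simp only: power_mult_distrib power2_minus distrib_left)
    also have "\<dots> \<le> ?a\<^sup>2 + ?b\<^sup>2" using s(2) by (intro mult_left_le_one_le) auto
    finally show ?thesis using slopes_le_exit_weight[OF I(1,2), of x] by simp
  qed
  note int = integrable_test_function[OF u]
  have hd: "hderiv 1 0 u = X1 u" "hderiv 0 1 u = X2 u"
    by (auto simp: hderiv_def)
  note ik = integrable_weight[OF u ibp1(2)] integrable_weight[OF u ibp2(2)]
  have zero: "- 2 * (u x \<bullet> v) = 0" if "x \<notin> closure {x. u x \<noteq> 0}" for x v
    using test_function_zero(1)[OF u that] by simp
  have ih1: "integrable lebesgue (\<lambda>x. h1 x * (- 2 * (u x \<bullet> X1 u x)))"
    by (rule int[OF ibp1(1)]) (intro continuous_intros continuous_on_test_function[OF u] zero)+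
  have ih2: "integrable lebesgue (\<lambda>x. h2 x * (- 2 * (u x \<bullet> X2 u x)))"
    by (rule int[OF ibp2(1)]) (intro continuous_intros continuous_on_test_function[OF u] zero)+
  have iE: "integrable lebesgue (\<lambda>x. exit_weight I x * (cmod (u x))\<^sup>2)"
    by (intro integrable_weight[OF u] continuous_on_exit_weight I)
  note iX = horizontal_energy_eq[OF u]
  have u0: "(cmod (u x))\<^sup>2 = 0" if "x \<notin> \<Omega>" for x
  proof -
    have "x \<notin> closure {x. u x \<noteq> 0}" using u that unfolding test_functions_def by blast
    from test_function_zero(1)[OF u this] show ?thesis by simp
  qed
  have "(\<integral>x. \<bar>n$3\<bar> / (c - n \<bullet> x) * (cmod (u x))\<^sup>2 \<partial>lebesgue)
      = (\<integral>x. k1 x * (cmod (u x))\<^sup>2 + k2 x * (cmod (u x))\<^sup>2 \<partial>lebesgue)"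
  proof (rule Bochner_Integration.integral_cong[OF refl])
    fix x
    show "\<bar>n$3\<bar> / (c - n \<bullet> x) * (cmod (u x))\<^sup>2 = k1 x * (cmod (u x))\<^sup>2 + k2 x * (cmod (u x))\<^sup>2"
    proof (cases "x \<in> \<Omega>")
      case True
      show ?thesis unfolding ksum[OF True, symmetric] by (rule distrib_right)
    next
      case False
      show ?thesis unfolding u0[OF False] by simp
    qed
  qed
  also have "\<dots> \<le> (\<integral>x. h1 x * (- 2 * (u x \<bullet> X1 u x)) \<partial>lebesgue) + (\<integral>x. h2 x * (- 2 * (u x \<bullet> X2 u x)) \<partial>lebesgue)"
    using add_mono[OF ibp1(3) ibp2(3)] unfolding Bochner_Integration.integral_add[OF ik] hd .
  also have "\<dots> = (\<integral>x. h1 x * (- 2 * (u x \<bullet> X1 u x)) + h2 x * (- 2 * (u x \<bullet> X2 u x)) \<partial>lebesgue)"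
    using ih1 ih2 by simp
  also have "\<dots> \<le> (\<integral>x. exit_weight I x * (cmod (u x))\<^sup>2 + ((cmod (X1 u x))\<^sup>2 + (cmod (X2 u x))\<^sup>2) \<partial>lebesgue)"
  proof (intro integral_mono Bochner_Integration.integrable_add ih1 ih2 iE iX(1,2))
    fix x
    have young: "a * (- 2 * (v \<bullet> w)) \<le> a\<^sup>2 * (cmod v)\<^sup>2 + (cmod w)\<^sup>2" for a :: real and v w :: complex
    proof -
      have "0 \<le> (a *\<^sub>R v + w) \<bullet> (a *\<^sub>R v + w)" by simp
      also have "\<dots> = a\<^sup>2 * (cmod v)\<^sup>2 + (cmod w)\<^sup>2 - a * (- 2 * (v \<bullet> w))"
        unfolding power2_norm_eq_inner power2_eq_square[of a]
        by (simp add: inner_add_left inner_add_right inner_commute algebra_simps)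
      finally show ?thesis by simp
    qed
    have "(h1 x)\<^sup>2 * (cmod (u x))\<^sup>2 + (h2 x)\<^sup>2 * (cmod (u x))\<^sup>2 \<le> exit_weight I x * (cmod (u x))\<^sup>2"
      unfolding distrib_right[symmetric] by (intro mult_right_mono hsum) simp
    then show "h1 x * (- 2 * (u x \<bullet> X1 u x)) + h2 x * (- 2 * (u x \<bullet> X2 u x))
      \<le> exit_weight I x * (cmod (u x))\<^sup>2 + ((cmod (X1 u x))\<^sup>2 + (cmod (X2 u x))\<^sup>2)"
      using young[of "h1 x" "u x" "X1 u x"] young[of "h2 x" "u x" "X2 u x"] by linarith
  qed
  also have "\<dots> = (\<integral>x. exit_weight I x * (cmod (u x))\<^sup>2 \<partial>lebesgue) + horizontal_energy u"
    using iE iX by (simp add: Bochner_Integration.integral_add)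
  also have "\<dots> \<le> 9 * horizontal_energy u"
    using hardy_exit_weight[OF assms(1) u I(1,3)] by simp
  finally show ?thesis .
qed

section \<open>The constant\<close>

lemma hardy_constant_exists:
  assumes "m > 0"
  shows "\<exists>c. is_hardy_constant m c"
proof -
  define F where "F = (\<lambda>c::real. c powr (4/3) * pi * real m * sqrt (c\<^sup>2 + 16) * (1 + c / (48 * sqrt 6)) powr (2/3))"
  have cont: "continuous_on {0..16/3} F"
    unfolding F_def
  proof (intro continuous_on_mult continuous_on_const continuous_on_real_sqrt)
    show "continuous_on {0..16/3} (\<lambda>c::real. c powr (4/3))"
      by (rule continuous_on_powr') (auto intro: continuous_on_id continuous_on_const)
    show "continuous_on {0..16/3} (\<lambda>c::real. c\<^sup>2 + 16)"
      by (intro continuous_on_add continuous_on_power continuous_on_id continuous_on_const)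
    show "continuous_on {0..16/3} (\<lambda>c::real. (1 + c / (48 * sqrt 6)) powr (2/3))"
    proof (rule continuous_on_powr')
      show "continuous_on {0..16/3} (\<lambda>c::real. 1 + c / (48 * sqrt 6))"
        by (intro continuous_on_add continuous_on_divide continuous_on_id continuous_on_const) simp
      show "\<forall>c\<in>{0..16/3::real}. 0 \<le> 1 + c / (48 * sqrt 6) \<and> (1 + c / (48 * sqrt 6) = 0 \<longrightarrow> 0 < (2/3::real))"
        by auto
    qed (rule continuous_on_const)
  qed
  have F0: "F 0 = 0" by (simp add: F_def)
  (* At 16/3 the square root alone reaches the target, and the other factors are at least 1. *)
  have "16/3 \<le> F (16/3)"
  proof -
    have a: "1 \<le> (16/3::real) powr (4/3)" by (rule ge_one_powr_ge_zero) auto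
    have b: "1 \<le> (1 + (16/3) / (48 * sqrt 6)) powr (2/3::real)" by (rule ge_one_powr_ge_zero) auto
    have c: "16/3 \<le> sqrt ((16/3)\<^sup>2 + 16)" by (rule real_le_rsqrt) simp
    have d: "1 \<le> pi" "1 \<le> real m" using pi_gt3 assms by linarith+
    have "1 * 1 * 1 * (16/3) * 1 \<le> F (16/3)"
      unfolding F_def by (rule mult_mono a b c d mult_nonneg_nonneg zero_le_one pi_ge_zero of_nat_0_le_iff
          powr_ge_zero real_sqrt_ge_zero | simp)+
    then show ?thesis by simp
  qed
  then obtain c where c: "0 \<le> c" "c \<le> 16/3" "F c = 16/3"
    using IVT'[of F 0 "16/3" "16/3"] cont F0 by auto
  have "c \<noteq> 0" using c(3) F0 by auto
  then have "c > 0" using c(1) by simp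
  then show ?thesis
    using c(3) unfolding is_hardy_constant_def F_def by blast
qed

text \<open>
  The defining equation forces \<open>c powr (4/3) * m \<le> 4/9\<close>, so the constant is smaller than \<open>1 / (1000 m)\<close>,
  far below the constant \<open>1 / (64 + 18 m)\<close> of the direct argument.
\<close>
lemma hardy_constant_bound:
  assumes "is_hardy_constant m c" "m > 0"
  shows "1/5 * (48 * sqrt 6 / c + 1) powr (- (4/3)) * (64 + 18 * real m) \<le> 1"
proof -
  have "c > 0" and eq: "c powr (4/3) * pi * real m * sqrt (c\<^sup>2 + 16) * (1 + c / (48 * sqrt 6)) powr (2/3) = 16/3"
    using assms by (auto simp: is_hardy_constant_def)
  define a where "a = c powr (4/3)"
  define X where "X = (48 * sqrt 6 / c + 1) powr (4/3)"
  have a: "a > 0" using \<open>c > 0\<close> by (simp add: a_def)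
  have "a * 3 * real m * 4 * 1
      \<le> a * pi * real m * sqrt (c\<^sup>2 + 16) * (1 + c / (48 * sqrt 6)) powr (2/3)"
  proof (intro mult_mono)
    show "1 \<le> (1 + c / (48 * sqrt 6)) powr (2/3)"
      using \<open>c > 0\<close> by (intro ge_one_powr_ge_zero) auto
    show "4 \<le> sqrt (c\<^sup>2 + 16)" by (rule real_le_rsqrt) simp
  qed (use pi_gt3 a in auto)
  then have "12 * (a * real m) \<le> 16/3"
    unfolding a_def eq by (simp only: mult_ac)
  then have am: "a * real m \<le> 4/9" by linarith
  have "sqrt 6 \<ge> 2" by (rule real_le_rsqrt) simp
  have "(96::real) powr 1 \<le> 96 powr (4/3)"
    by (rule powr_mono) auto
  then have "96 / a \<le> (96::real) powr (4/3) / a"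
    using a by (intro divide_right_mono) auto
  also have "\<dots> = (96 / c) powr (4/3)"
    unfolding a_def by (rule powr_divide[symmetric])
  also have "\<dots> \<le> X"
    unfolding X_def
  proof (rule powr_mono2)
    have "96 / c \<le> 48 * sqrt 6 / c"
      using \<open>sqrt 6 \<ge> 2\<close> \<open>c > 0\<close> by (intro divide_right_mono) auto
    then show "96 / c \<le> 48 * sqrt 6 / c + 1" by linarith
  qed (use \<open>c > 0\<close> in auto)
  finally have X: "96 / a \<le> X" .
  have "(48 * sqrt 6 / c + 1) powr (- (4/3)) = 1 / X"
    unfolding X_def by (rule powr_minus_divide)
  also have "1 / X \<le> 1 / (96 / a)"
    using X a by (intro divide_left_mono mult_pos_pos less_le_trans[OF _ X]) auto
  also have "\<dots> = a / 96" by simp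
  finally have K: "(48 * sqrt 6 / c + 1) powr (- (4/3)) \<le> a / 96" .
  have "64 + 18 * real m \<le> 82 * real m" using assms(2) by simp
  then have "1/5 * (48 * sqrt 6 / c + 1) powr (- (4/3)) * (64 + 18 * real m)
      \<le> 1/5 * (a / 96) * (82 * real m)"
    using K a by (intro mult_mono mult_left_mono) auto
  also have "\<dots> = 82 / 480 * (a * real m)" by simp
  also have "\<dots> \<le> 82 / 480 * (4/9)" by (intro mult_left_mono am) simp
  also have "\<dots> \<le> 1" by simp
  finally show ?thesis .
qed

section \<open>Faces of the polytope\<close>

lemma facet_hyperplane:
  fixes \<Omega> :: "heis set"
  assumes P: "open_convex_polytope \<Omega>" and "F facet_of closure \<Omega>"
  obtains n c where "n \<noteq> 0" "affine hull F = {y. n \<bullet> y = c}" "F \<subseteq> {y. n \<bullet> y = c}"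
    "\<And>x. x \<in> \<Omega> \<Longrightarrow> n \<bullet> x < c"
proof -
  have \<Omega>: "open \<Omega>" "convex \<Omega>" "\<Omega> \<noteq> {}" "polyhedron (closure \<Omega>)"
    using P by (auto simp: open_convex_polytope_def intro: polytope_imp_polyhedron)
  obtain n c where nc: "n \<noteq> 0" "closure \<Omega> \<subseteq> {x. n \<bullet> x \<le> c}" "F = closure \<Omega> \<inter> {x. n \<bullet> x = c}"
    using facet_of_polyhedron[OF \<Omega>(4) assms(2)] by blast
  have "F \<noteq> {}" using assms(2) by (simp add: facet_of_def)
  have "interior (closure \<Omega>) \<noteq> {}"
    using \<Omega> interior_maximal[OF closure_subset \<Omega>(1)] by blast
  then have "aff_dim (closure \<Omega>) = DIM(heis)"
    by (rule aff_dim_nonempty_interior)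
  then have dimF: "aff_dim F = DIM(heis) - 1"
    using assms(2) by (simp add: facet_of_def)
  have "affine hull F = {y. n \<bullet> y = c}"
  proof (rule affine_dim_equal)
    show "affine hull F \<subseteq> {y. n \<bullet> y = c}"
      by (rule hull_minimal) (auto simp: nc affine_hyperplane)
    show "aff_dim (affine hull F) = aff_dim {y. n \<bullet> y = c}"
      using dimF nc(1) by simp
  qed (use \<open>F \<noteq> {}\<close> in \<open>auto simp: affine_hyperplane\<close>)
  moreover have "n \<bullet> x < c" if "x \<in> \<Omega>" for x
  proof -
    have "\<Omega> \<subseteq> interior {x. n \<bullet> x \<le> c}"
      using nc(2) closure_subset \<Omega>(1) by (intro interior_maximal) auto
    then show ?thesis using that nc(1) by (auto simp: interior_halfspace_le)
  qed
  ultimately show ?thesis using that[of n c] nc by blast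
qed

lemma polytope_halfspaces:
  fixes \<Omega> :: "heis set"
  assumes P: "open_convex_polytope \<Omega>"
  obtains I :: "(heis \<times> real) set" where "finite I"
    "\<And>n c x. (n, c) \<in> I \<Longrightarrow> x \<in> \<Omega> \<Longrightarrow> n \<bullet> x < c"
    "\<And>y. y \<in> frontier \<Omega> \<Longrightarrow> \<exists>(n, c)\<in>I. n \<bullet> y = c"
    "card {(n, c)\<in>I. n$3 \<noteq> 0} \<le> num_nonorthogonal_hyperplanes \<Omega>"
proof -
  have \<Omega>: "open \<Omega>" "convex \<Omega>" "\<Omega> \<noteq> {}" "polyhedron (closure \<Omega>)"
    using P by (auto simp: open_convex_polytope_def intro: polytope_imp_polyhedron)
  have fin: "finite (boundary_hyperplanes \<Omega>)"
    using finite_polyhedron_facets[OF \<Omega>(4)] by (simp add: boundary_hyperplanes_def setcompr_eq_image)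
  have "\<forall>H\<in>boundary_hyperplanes \<Omega>. \<exists>nc. H = {y. fst nc \<bullet> y = snd nc} \<and> (\<forall>x\<in>\<Omega>. fst nc \<bullet> x < snd nc)"
  proof
    fix H assume "H \<in> boundary_hyperplanes \<Omega>"
    then obtain F where F: "F facet_of closure \<Omega>" "H = affine hull F"
      by (auto simp: boundary_hyperplanes_def)
    obtain n c where "affine hull F = {y. n \<bullet> y = c}" "\<And>x. x \<in> \<Omega> \<Longrightarrow> n \<bullet> x < c"
      using facet_hyperplane[OF P F(1)] by metis
    then show "\<exists>nc. H = {y. fst nc \<bullet> y = snd nc} \<and> (\<forall>x\<in>\<Omega>. fst nc \<bullet> x < snd nc)"
      using F(2) by (intro exI[of _ "(n, c)"]) auto
  qed
  then obtain e where e: "\<And>H. H \<in> boundary_hyperplanes \<Omega> \<Longrightarrow> H = {y. fst (e H) \<bullet> y = snd (e H)}"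
    "\<And>H x. H \<in> boundary_hyperplanes \<Omega> \<Longrightarrow> x \<in> \<Omega> \<Longrightarrow> fst (e H) \<bullet> x < snd (e H)"
    by metis
  define I where "I = e ` boundary_hyperplanes \<Omega>"
  show ?thesis
  proof (rule that[of I])
    show "finite I" using fin by (simp add: I_def)
    show "n \<bullet> x < c" if "(n, c) \<in> I" "x \<in> \<Omega>" for n c x
    proof -
      from that(1) obtain H where "H \<in> boundary_hyperplanes \<Omega>" "e H = (n, c)"
        unfolding I_def by (metis imageE)
      then show ?thesis using e(2)[of H x] that(2) by simp
    qed
    show "\<exists>(n, c)\<in>I. n \<bullet> y = c" if "y \<in> frontier \<Omega>" for y
    proof -
      have ri: "rel_interior (closure \<Omega>) = \<Omega>"
        using \<Omega> by (simp add: convex_rel_interior_closure rel_interior_open)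
      have "y \<in> closure \<Omega> - rel_interior (closure \<Omega>)"
        using that \<Omega>(1) by (simp add: ri frontier_def interior_open)
      then obtain F where F: "F facet_of closure \<Omega>" "y \<in> F"
        using rel_boundary_of_polyhedron[OF \<Omega>(4)] by auto
      then have H: "affine hull F \<in> boundary_hyperplanes \<Omega>"
        by (auto simp: boundary_hyperplanes_def)
      have "y \<in> affine hull F" using F(2) by (rule hull_inc)
      then have "fst (e (affine hull F)) \<bullet> y = snd (e (affine hull F))"
        using e(1)[OF H] by blast
      then show ?thesis
        using H by (intro bexI[of _ "e (affine hull F)"]) (auto simp: I_def split: prod.split)
    qed
    have "{(n, c)\<in>I. n$3 \<noteq> 0} \<subseteq> e ` {H \<in> boundary_hyperplanes \<Omega>. not_orthogonal_to_horizontal H}"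
    proof
      fix i assume "i \<in> {(n, c)\<in>I. n$3 \<noteq> 0}"
      then have "i \<in> I" and i3: "fst i $ 3 \<noteq> 0" by (auto split: prod.splits)
      then obtain H where H: "H \<in> boundary_hyperplanes \<Omega>" "i = e H"
        unfolding I_def by blast
      with i3 have "fst (e H) $ 3 \<noteq> 0" by simp
      then have "not_orthogonal_to_horizontal H"
        unfolding not_orthogonal_to_horizontal_def using e(1)[OF H(1)] by (intro exI conjI)
      then show "i \<in> e ` {H \<in> boundary_hyperplanes \<Omega>. not_orthogonal_to_horizontal H}"
        using H by blast
    qed
    then show "card {(n, c)\<in>I. n$3 \<noteq> 0} \<le> num_nonorthogonal_hyperplanes \<Omega>"
      unfolding num_nonorthogonal_hyperplanes_def
      using fin by (intro surj_card_le) simp_all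
  qed
qed

section \<open>The Carnot-Caratheodory distance to the boundary\<close>

text \<open>
  A curve of length \<open>l\<close> from \<open>x\<close> to a face at height \<open>d\<close> satisfies
  \<open>d \<le> (\<bar>n \<bullet> X1\<bar> + \<bar>n \<bullet> X2\<bar>) l + \<bar>n3\<bar> l\<^sup>2\<close>, so one of the two terms is at least \<open>d / 2\<close>. The first
  alternative bounds \<open>1 / l\<^sup>2\<close> by the slope weight, the second by \<open>2 \<bar>n3\<bar> / d\<close>.
\<close>
lemma inverse_boundary_distance_bound:
  assumes I: "finite I" "\<And>n c x. (n, c) \<in> I \<Longrightarrow> x \<in> \<Omega> \<Longrightarrow> n \<bullet> x < c"
    and front: "\<And>y. y \<in> frontier \<Omega> \<Longrightarrow> \<exists>(n, c)\<in>I. n \<bullet> y = c"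
    and "frontier \<Omega> \<noteq> {}" and x: "x \<in> \<Omega>"
  defines "W \<equiv> 8 * exit_weight I x + 2 * (\<Sum>(n, c)\<in>{(n, c)\<in>I. n$3 \<noteq> 0}. \<bar>n$3\<bar> / (c - n \<bullet> x))"
  shows "1 / (cc_dist_boundary \<Omega> x)\<^sup>2 \<le> W" "0 \<le> W"
proof -
  let ?S = "\<Sum>(n, c)\<in>{(n, c)\<in>I. n$3 \<noteq> 0}. \<bar>n$3\<bar> / (c - n \<bullet> x)"
  have nonneg: "0 \<le> \<bar>n$3\<bar> / (c - n \<bullet> x)" if "(n, c) \<in> I" for n c
    using I(2)[OF that x] by simp
  then have "0 \<le> ?S" by (intro sum_nonneg) auto
  then show "0 \<le> W" using exit_weight_nonneg[of I x] by (simp add: W_def)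
  have len: "0 \<le> horizontal_length a b \<gamma>" "1 \<le> W * (horizontal_length a b \<gamma>)\<^sup>2"
    if \<gamma>: "horizontal_curve a b \<gamma>" "\<gamma> a = x" "\<gamma> b \<in> frontier \<Omega>" for a b \<gamma>
  proof -
    define l where "l = horizontal_length a b \<gamma>"
    show "0 \<le> horizontal_length a b \<gamma>" by (rule horizontal_curve_displacement(2)[OF \<gamma>(1)])
    obtain n c where nc: "(n, c) \<in> I" "n \<bullet> \<gamma> b = c" using front[OF \<gamma>(3)] by blast
    define d where "d = c - n \<bullet> x"
    have "d > 0" using I(2)[OF nc(1) x] by (simp add: d_def)
    let ?a = "n \<bullet> hfield 1 0 x" and ?b = "n \<bullet> hfield 0 1 x"
    have disp: "d \<le> (\<bar>?a\<bar> + \<bar>?b\<bar>) * l + \<bar>n$3\<bar> * l\<^sup>2"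
      using horizontal_curve_displacement(1)[OF \<gamma>(1), of n] nc(2) \<gamma>(2) by (simp add: l_def d_def)
    define r r' where "r = ?a / d" and "r' = ?b / d"
    have E: "r\<^sup>2 + r'\<^sup>2 \<le> exit_weight I x"
      using slopes_le_exit_weight[OF I(1) nc(1), of x] by (simp only: d_def r_def r'_def)
    have "1 \<le> W * l\<^sup>2"
    proof (cases "d / 2 \<le> (\<bar>?a\<bar> + \<bar>?b\<bar>) * l")
      case True
      then have "1 \<le> 2 * (\<bar>r\<bar> + \<bar>r'\<bar>) * l"
        using \<open>d > 0\<close> by (simp add: r_def r'_def field_simps)
      then have "1\<^sup>2 \<le> (2 * (\<bar>r\<bar> + \<bar>r'\<bar>) * l)\<^sup>2" by (rule power_mono) simp
      also have "\<dots> = 4 * (\<bar>r\<bar> + \<bar>r'\<bar>)\<^sup>2 * l\<^sup>2"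
        unfolding power_mult_distrib by simp
      also have "\<dots> \<le> 4 * (2 * (r\<^sup>2 + r'\<^sup>2)) * l\<^sup>2"
      proof (intro mult_right_mono mult_left_mono)
        have "(v + w)\<^sup>2 \<le> 2 * (v\<^sup>2 + w\<^sup>2)" for v w :: real
          using zero_le_power2[of "v - w"] by (simp add: power2_sum power2_diff)
        from this[of "\<bar>r\<bar>" "\<bar>r'\<bar>"] show "(\<bar>r\<bar> + \<bar>r'\<bar>)\<^sup>2 \<le> 2 * (r\<^sup>2 + r'\<^sup>2)"
          by (simp only: power2_abs)
      qed auto
      also have "\<dots> \<le> W * l\<^sup>2"
        using E \<open>0 \<le> ?S\<close> unfolding W_def by (intro mult_right_mono) auto
      finally show ?thesis by simp
    next
      case False
      with disp have "d / 2 \<le> \<bar>n$3\<bar> * l\<^sup>2" by linarith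
      then have "1 \<le> 2 * (\<bar>n$3\<bar> / d) * l\<^sup>2" using \<open>d > 0\<close> by (simp add: field_simps)
      moreover have "\<bar>n$3\<bar> / d \<le> ?S"
      proof -
        have "n$3 \<noteq> 0" using \<open>d / 2 \<le> \<bar>n$3\<bar> * l\<^sup>2\<close> \<open>d > 0\<close> by auto
        have "(case (n, c) of (n, c) \<Rightarrow> \<bar>n$3\<bar> / (c - n \<bullet> x)) \<le> ?S"
          by (rule member_le_sum) (use I(1) nc(1) nonneg \<open>n$3 \<noteq> 0\<close> in \<open>auto intro: finite_subset[of _ I]\<close>)
        then show ?thesis by (simp add: d_def)
      qed
      then have "2 * (\<bar>n$3\<bar> / d) * l\<^sup>2 \<le> W * l\<^sup>2"
        using exit_weight_nonneg[of I x] unfolding W_def by (intro mult_right_mono) auto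
      ultimately show ?thesis by linarith
    qed
    then show "1 \<le> W * (horizontal_length a b \<gamma>)\<^sup>2" by (simp add: l_def)
  qed
  have W: "W > 0"
  proof -
    obtain y where y: "y \<in> frontier \<Omega>" using \<open>frontier \<Omega> \<noteq> {}\<close> by blast
    obtain \<gamma> where "horizontal_curve 0 1 \<gamma>" "\<gamma> 0 = x" "\<gamma> 1 = y"
      using horizontal_curve_exists[of x y] by metis
    then have "1 \<le> W * (horizontal_length 0 1 \<gamma>)\<^sup>2" using len(2) y by blast
    then have "W \<noteq> 0" by auto
    then show ?thesis using \<open>0 \<le> W\<close> by simp
  qed
  have "1 / sqrt W \<le> cc_dist x y" if y: "y \<in> frontier \<Omega>" for y
    unfolding cc_dist_def
  proof (rule cInf_greatest)
    obtain \<gamma> where "horizontal_curve 0 1 \<gamma>" "\<gamma> 0 = x" "\<gamma> 1 = y"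
      using horizontal_curve_exists[of x y] by metis
    then show "{horizontal_length a b \<gamma> | a b \<gamma>. horizontal_curve a b \<gamma> \<and> \<gamma> a = x \<and> \<gamma> b = y} \<noteq> {}"
      by blast
    fix l assume "l \<in> {horizontal_length a b \<gamma> | a b \<gamma>. horizontal_curve a b \<gamma> \<and> \<gamma> a = x \<and> \<gamma> b = y}"
    then have l: "0 \<le> l" "1 \<le> W * l\<^sup>2" using len y by blast+
    then have "1 \<le> sqrt (W * l\<^sup>2)" by simp
    also have "\<dots> = sqrt W * l" using l(1) by (simp add: real_sqrt_mult)
    finally show "1 / sqrt W \<le> l" using W by (simp add: field_simps)
  qed
  then have "1 / sqrt W \<le> cc_dist_boundary \<Omega> x"
    unfolding cc_dist_boundary_def using \<open>frontier \<Omega> \<noteq> {}\<close> by (intro cINF_greatest)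
  then have "(1 / sqrt W)\<^sup>2 \<le> (cc_dist_boundary \<Omega> x)\<^sup>2"
    using W by (intro power_mono) auto
  then have "1 / W \<le> (cc_dist_boundary \<Omega> x)\<^sup>2"
    using W by (simp add: power_divide)
  then have "1 / (cc_dist_boundary \<Omega> x)\<^sup>2 \<le> 1 / (1 / W)"
    using W by (intro frac_le) auto
  then show "1 / (cc_dist_boundary \<Omega> x)\<^sup>2 \<le> W" by simp
qed

text \<open>
  The slope weight of all faces together costs the constant 64, because the maximum over the faces is taken
  before integrating; the reciprocal height of each non-vertical face then adds 18.
\<close>
lemma hardy_cc_distance:
  assumes P: "open_convex_polytope \<Omega>" and u: "u \<in> test_functions \<Omega>"
  shows "(LINT x:\<Omega>|lebesgue. (cmod (u x))\<^sup>2 / (cc_dist_boundary \<Omega> x)\<^sup>2)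
    \<le> (64 + 18 * real (num_nonorthogonal_hyperplanes \<Omega>)) * horizontal_energy u"
proof -
  have \<Omega>: "open \<Omega>" "bounded \<Omega>" "\<Omega> \<noteq> {}"
    using P by (auto simp: open_convex_polytope_def)
  have front: "frontier \<Omega> \<noteq> {}"
  proof -
    have "\<Omega> \<noteq> UNIV" using \<Omega>(2) not_bounded_UNIV by metis
    with \<Omega>(3) show ?thesis unfolding frontier_eq_empty by blast
  qed
  obtain I :: "(heis \<times> real) set" where I: "finite I"
    "\<And>n c x. (n, c) \<in> I \<Longrightarrow> x \<in> \<Omega> \<Longrightarrow> n \<bullet> x < c"
    and I_front: "\<And>y. y \<in> frontier \<Omega> \<Longrightarrow> \<exists>(n, c)\<in>I. n \<bullet> y = c"
    and I_card: "card {(n, c)\<in>I. n$3 \<noteq> 0} \<le> num_nonorthogonal_hyperplanes \<Omega>"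
    by (rule polytope_halfspaces[OF P], rule that)
  define J where "J = {(n, c)\<in>I. n$3 \<noteq> 0}"
  have J: "finite J" "J \<subseteq> I" using I(1) by (auto simp: J_def intro: finite_subset[of _ I])
  define g :: "heis \<times> real \<Rightarrow> heis \<Rightarrow> real" where "g = (\<lambda>(n, c) x. \<bar>n$3\<bar> / (c - n \<bullet> x))"
  define W where "W = (\<lambda>x. 8 * exit_weight I x + 2 * (\<Sum>i\<in>J. g i x))"
  have Wb: "1 / (cc_dist_boundary \<Omega> x)\<^sup>2 \<le> W x" "0 \<le> W x" if "x \<in> \<Omega>" for x
    using inverse_boundary_distance_bound[OF I I_front front that]
    unfolding W_def J_def g_def by (simp_all add: split_def)
  have D0: "0 \<le> horizontal_energy u" unfolding horizontal_energy_def by (intro integral_nonneg_AE AE_I2) simp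
  have iE: "integrable lebesgue (\<lambda>x. exit_weight I x * (cmod (u x))\<^sup>2)"
    by (rule integrable_weight[OF u continuous_on_exit_weight[OF I]])
  have ig: "integrable lebesgue (\<lambda>x. g i x * (cmod (u x))\<^sup>2)"
    and lg: "(\<integral>x. g i x * (cmod (u x))\<^sup>2 \<partial>lebesgue) \<le> 9 * horizontal_energy u" if i: "i \<in> J" for i
  proof -
    obtain n c where nc: "i = (n, c)" "(n, c) \<in> I" using i J(2) by (cases i) auto
    have half: "\<forall>x\<in>\<Omega>. n \<bullet> x < c" using I(2)[OF nc(2)] by blast
    have "continuous_on \<Omega> (\<lambda>x. \<bar>n$3\<bar> / (c - n \<bullet> x))"
      using half by (intro continuous_on_divide continuous_on_const continuous_on_diff continuous_on_inner continuous_on_id) force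
    from integrable_weight[OF u this] show "integrable lebesgue (\<lambda>x. g i x * (cmod (u x))\<^sup>2)"
      by (simp add: g_def nc(1))
    show "(\<integral>x. g i x * (cmod (u x))\<^sup>2 \<partial>lebesgue) \<le> 9 * horizontal_energy u"
      using hardy_vertical_distance[OF \<Omega>(1) u half] by (simp add: g_def nc(1))
  qed
  have W_eq: "W x * (cmod (u x))\<^sup>2 = 8 * (exit_weight I x * (cmod (u x))\<^sup>2) + 2 * (\<Sum>i\<in>J. g i x * (cmod (u x))\<^sup>2)" for x
    by (simp add: W_def distrib_right sum_distrib_right mult.assoc)
  have iW: "integrable lebesgue (\<lambda>x. W x * (cmod (u x))\<^sup>2)"
    unfolding W_eq by (intro Bochner_Integration.integrable_add integrable_mult_right iE
        Bochner_Integration.integrable_sum ig)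
  have u0: "u x = 0" if "x \<notin> \<Omega>" for x
  proof -
    have "x \<notin> closure {x. u x \<noteq> 0}" using u that unfolding test_functions_def by blast
    then show ?thesis by (rule test_function_zero(1)[OF u])
  qed
  (* The distance need not be known to be measurable: the comparison of integrals asks for
     integrability of the larger function only. *)
  have "(LINT x:\<Omega>|lebesgue. (cmod (u x))\<^sup>2 / (cc_dist_boundary \<Omega> x)\<^sup>2) \<le> (\<integral>x. W x * (cmod (u x))\<^sup>2 \<partial>lebesgue)"
    unfolding set_lebesgue_integral_def
  proof (rule integral_mono'[OF iW])
    fix x
    have "indicator \<Omega> x *\<^sub>R ((cmod (u x))\<^sup>2 / (cc_dist_boundary \<Omega> x)\<^sup>2) \<le> W x * (cmod (u x))\<^sup>2
        \<and> 0 \<le> W x * (cmod (u x))\<^sup>2"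
    proof (cases "x \<in> \<Omega>")
      case True
      from mult_right_mono[OF Wb(1)[OF True], of "(cmod (u x))\<^sup>2"] Wb(2)[OF True] True
      show ?thesis by simp
    next
      case False
      then show ?thesis using u0[OF False] by simp
    qed
    then show "indicator \<Omega> x *\<^sub>R ((cmod (u x))\<^sup>2 / (cc_dist_boundary \<Omega> x)\<^sup>2) \<le> W x * (cmod (u x))\<^sup>2"
      and "0 \<le> W x * (cmod (u x))\<^sup>2" by blast+
  qed
  also have "\<dots> = 8 * (\<integral>x. exit_weight I x * (cmod (u x))\<^sup>2 \<partial>lebesgue)
      + 2 * (\<Sum>i\<in>J. \<integral>x. g i x * (cmod (u x))\<^sup>2 \<partial>lebesgue)"
    unfolding W_eq
    by (simp only: Bochner_Integration.integral_add Bochner_Integration.integral_sum integral_mult_right_zero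
        integrable_mult_right Bochner_Integration.integrable_sum iE ig)
  also have "\<dots> \<le> 8 * (8 * horizontal_energy u) + 2 * (real (card J) * (9 * horizontal_energy u))"
    using hardy_exit_weight[OF \<Omega>(1) u I] sum_bounded_above[of J, OF lg] by (intro add_mono mult_left_mono) auto
  also have "\<dots> = (64 + 18 * real (card J)) * horizontal_energy u" by (simp add: algebra_simps)
  also have "\<dots> \<le> (64 + 18 * real (num_nonorthogonal_hyperplanes \<Omega>)) * horizontal_energy u"
    using I_card D0 by (intro mult_right_mono) (auto simp: J_def)
  finally show ?thesis .
qed

text \<open>
  A vertical line through an interior point has to cross the boundary of a bounded set, and it cannot
  do so through a vertical face.
\<close>
lemma num_nonorthogonal_hyperplanes_pos:
  assumes P: "open_convex_polytope \<Omega>"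
  shows "num_nonorthogonal_hyperplanes \<Omega> > 0"
proof -
  have \<Omega>: "open \<Omega>" "bounded \<Omega>" "\<Omega> \<noteq> {}"
    using P by (auto simp: open_convex_polytope_def)
  obtain I :: "(heis \<times> real) set" where I: "finite I"
    "\<And>n c x. (n, c) \<in> I \<Longrightarrow> x \<in> \<Omega> \<Longrightarrow> n \<bullet> x < c"
    and I_front: "\<And>y. y \<in> frontier \<Omega> \<Longrightarrow> \<exists>(n, c)\<in>I. n \<bullet> y = c"
    and I_card: "card {(n, c)\<in>I. n$3 \<noteq> 0} \<le> num_nonorthogonal_hyperplanes \<Omega>"
    by (rule polytope_halfspaces[OF P], rule that)
  obtain x where x: "x \<in> \<Omega>" using \<Omega>(3) by blast
  have "axis 3 1 \<noteq> (0 :: heis)" by (simp add: axis_eq_0_iff)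
  then obtain t where "x + t *\<^sub>R axis 3 1 \<in> frontier \<Omega>"
    using ray_to_frontier[OF \<Omega>(2), of x "axis 3 1"] x \<Omega>(1) by (auto simp: interior_open)
  from I_front[OF this] obtain n c where nc: "(n, c) \<in> I" "n \<bullet> (x + t *\<^sub>R axis 3 1) = c" by blast
  have "n \<bullet> x + t * n$3 = c" using nc(2) by (simp add: inner_add_right inner_axis)
  then have "n$3 \<noteq> 0" using I(2)[OF nc(1) x] by auto
  then have "{(n, c)\<in>I. n$3 \<noteq> 0} \<noteq> {}" using nc(1) by blast
  moreover have "finite {(n, c)\<in>I. n$3 \<noteq> 0}" using I(1) by (auto intro: finite_subset[of _ I])
  ultimately have "card {(n, c)\<in>I. n$3 \<noteq> 0} > 0" by (simp add: card_gt_0_iff)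
  then show ?thesis using I_card by simp
qed

theorem theorem3p2:
  fixes \<Omega> :: "heis set" and m :: nat
  assumes "open_convex_polytope \<Omega>"
    and "m = num_nonorthogonal_hyperplanes \<Omega>"
  shows "(\<exists>c. is_hardy_constant m c) \<and>
    (\<forall>c. is_hardy_constant m c \<longrightarrow>
      (\<forall>u\<in>test_functions \<Omega>.
        1/5 * (48 * sqrt 6 / c + 1) powr (- (4/3)) *
          (LINT x:\<Omega>|lebesgue. (cmod (u x))\<^sup>2 / (cc_dist_boundary \<Omega> x)\<^sup>2)
        \<le> (LINT x:\<Omega>|lebesgue. (subgradient_norm u x)\<^sup>2)))"
proof (intro conjI allI impI ballI)
  have m: "m > 0" using num_nonorthogonal_hyperplanes_pos[OF assms(1)] assms(2) by simp
  then show "\<exists>c. is_hardy_constant m c" by (rule hardy_constant_exists)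
  fix c u
  assume c: "is_hardy_constant m c" and u: "u \<in> test_functions \<Omega>"
  let ?K = "1/5 * (48 * sqrt 6 / c + 1) powr (- (4/3))"
  have D0: "0 \<le> horizontal_energy u" unfolding horizontal_energy_def by (intro integral_nonneg_AE AE_I2) simp
  have D: "(LINT x:\<Omega>|lebesgue. (subgradient_norm u x)\<^sup>2) = horizontal_energy u"
    unfolding horizontal_energy_def set_lebesgue_integral_def
  proof (rule Bochner_Integration.integral_cong[OF refl])
    fix x
    show "indicator \<Omega> x *\<^sub>R (subgradient_norm u x)\<^sup>2 = (subgradient_norm u x)\<^sup>2"
    proof (cases "x \<in> \<Omega>")
      case False
      have "x \<notin> closure {x. u x \<noteq> 0}" using u False unfolding test_functions_def by blast
      from test_function_zero(2,3)[OF u this] show ?thesis by (simp add: subgradient_norm_def)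
    qed simp
  qed
  have "?K * (LINT x:\<Omega>|lebesgue. (cmod (u x))\<^sup>2 / (cc_dist_boundary \<Omega> x)\<^sup>2)
      \<le> ?K * ((64 + 18 * real m) * horizontal_energy u)"
    using hardy_cc_distance[OF assms(1) u] unfolding assms(2) by (intro mult_left_mono) simp_all
  also have "\<dots> = (?K * (64 + 18 * real m)) * horizontal_energy u" by (simp only: mult.assoc)
  also have "\<dots> \<le> 1 * horizontal_energy u"
    by (intro mult_right_mono hardy_constant_bound[OF c m] D0)
  finally show "?K * (LINT x:\<Omega>|lebesgue. (cmod (u x))\<^sup>2 / (cc_dist_boundary \<Omega> x)\<^sup>2)
      \<le> (LINT x:\<Omega>|lebesgue. (subgradient_norm u x)\<^sup>2)"
    by (simp add: D)
qed

end
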